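(* Let $\mathscr{H}$ be a complex Hilbert space, $S\in\mathscr{B}(\mathscr{H})$, $0\le\alpha\le1$ and $r\ge2$. Then $$dw^r(S)\le\frac{2^{r/2}}{4}\left\| |S|^{2r\alpha}+|S^*|^{2r(1-\alpha)}+|S^*S|^{2r\alpha}+|S^*S|^{2r(1-\alpha)}\right\|.$$
   Context: $\mathscr{B}(\mathscr{H})$ is the algebra of bounded linear operators on the complex Hilbert space $\mathscr{H}$, $\|\cdot\|$ is the operator norm, $|A|=(A^*A)^{1/2}$, and real powers of positive operators are defined by functional calculus. The Davis--Wielandt radius of $S$ is $dw(S)=\sup_{\|x\|=1}\sqrt{|\langle Sx,x\rangle|^2+\|Sx\|^4}$, the supremum being over unit vectors $x\in\mathscr{H}$; $dw^r(S)$ means $(dw(S))^r$. *)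

theory Defs
  imports "HOL-Analysis.Analysis" "HOL-Computational_Algebra.Polynomial"
begin

class complex_vector = real_vector +
  fixes scaleC :: "complex \<Rightarrow> 'a \<Rightarrow> 'a" (infixr "*\<^sub>C" 75)
  assumes scaleC_of_real: "complex_of_real r *\<^sub>C x = r *\<^sub>R x"
    and scaleC_add_right: "a *\<^sub>C (x + y) = a *\<^sub>C x + a *\<^sub>C y"
    and scaleC_add_left: "(a + b) *\<^sub>C x = a *\<^sub>C x + b *\<^sub>C x"
    and scaleC_scaleC: "a *\<^sub>C (b *\<^sub>C x) = (a * b) *\<^sub>C x"

text \<open>The inner product is linear in its first argument.\<close>

class complex_inner = complex_vector + real_normed_vector +
  fixes cinner :: "'a \<Rightarrow> 'a \<Rightarrow> complex"
  assumes cinner_commute: "cinner x y = cnj (cinner y x)"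
    and cinner_add_left: "cinner (x + y) z = cinner x z + cinner y z"
    and cinner_scaleC_left: "cinner (a *\<^sub>C x) y = a * cinner x y"
    and cinner_ge_zero: "0 \<le> Re (cinner x x)"
    and cinner_eq_zero_iff: "cinner x x = 0 \<longleftrightarrow> x = 0"
    and norm_eq_sqrt_cinner: "norm x = sqrt (Re (cinner x x))"

class chilbert_space = complex_inner + complete_space

text \<open>The type \<open>'a \<Rightarrow>\<^sub>L 'a\<close> consists of the bounded real-linear maps, normed by the operator norm;
  the bounded operators of the complex Hilbert space are those that also respect
  multiplication by complex scalars.\<close>

definition clinear_op :: "('a::complex_inner \<Rightarrow>\<^sub>L 'a) \<Rightarrow> bool" where
  "clinear_op A \<longleftrightarrow> (\<forall>c x. blinfun_apply A (c *\<^sub>C x) = c *\<^sub>C blinfun_apply A x)"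

definition adj :: "('a::chilbert_space \<Rightarrow>\<^sub>L 'a) \<Rightarrow> 'a \<Rightarrow>\<^sub>L 'a" where
  "adj A = (THE B. \<forall>x y. cinner (blinfun_apply A x) y = cinner x (blinfun_apply B y))"

definition op_spectrum :: "('a::chilbert_space \<Rightarrow>\<^sub>L 'a) \<Rightarrow> complex set" where
  "op_spectrum A = {z. \<not> (\<exists>R. clinear_op R \<and>
     (\<forall>x. blinfun_apply R (blinfun_apply A x - z *\<^sub>C x) = x) \<and>
     (\<forall>x. blinfun_apply A (blinfun_apply R x) - z *\<^sub>C blinfun_apply R x = x))}"

definition op_poly :: "real poly \<Rightarrow> ('a::chilbert_space \<Rightarrow>\<^sub>L 'a) \<Rightarrow> 'a \<Rightarrow>\<^sub>L 'a" where
  "op_poly p A = (\<Sum>i\<le>degree p. coeff p i *\<^sub>R ((\<lambda>B. A o\<^sub>L B) ^^ i) id_blinfun)"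

text \<open>Continuous functional calculus for self-adjoint \<open>A\<close> (whose spectrum is real) and real
  \<open>f\<close> continuous on the spectrum: \<open>f(A)\<close> is the common norm limit of \<open>p\<^sub>n(A)\<close> over all sequences
  of polynomials \<open>p\<^sub>n\<close> converging to \<open>f\<close> uniformly on the spectrum. Such sequences exist by the
  Weierstrass theorem.\<close>

definition op_cfc :: "(real \<Rightarrow> real) \<Rightarrow> ('a::chilbert_space \<Rightarrow>\<^sub>L 'a) \<Rightarrow> 'a \<Rightarrow>\<^sub>L 'a" where
  "op_cfc f A = (THE T. \<forall>p :: nat \<Rightarrow> real poly.
     uniform_limit {t. complex_of_real t \<in> op_spectrum A} (\<lambda>n. poly (p n)) f sequentially
       \<longrightarrow> (\<lambda>n. op_poly (p n) A) \<longlonglongrightarrow> T)"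

text \<open>For positive \<open>A\<close> and \<open>a \<ge> 0\<close>. The function \<open>t\<^sup>0\<close> is constantly 1, so that the zeroth power
  is the identity; since \<open>0 powr 0 = 0\<close>, plain \<open>powr\<close> with exponent 0 may be discontinuous on the
  spectrum.\<close>

definition op_powr :: "('a::chilbert_space \<Rightarrow>\<^sub>L 'a) \<Rightarrow> real \<Rightarrow> 'a \<Rightarrow>\<^sub>L 'a" where
  "op_powr A a = op_cfc (\<lambda>t. if a = 0 then 1 else t powr a) A"

definition op_abs :: "('a::chilbert_space \<Rightarrow>\<^sub>L 'a) \<Rightarrow> 'a \<Rightarrow>\<^sub>L 'a" where
  "op_abs A = op_powr (adj A o\<^sub>L A) (1/2)"

text \<open>The supremum of the empty set is taken to be 0 here; this concerns only the zero space,
  as \<open>Sup {}\<close> is unspecified on the reals.\<close>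

definition dw :: "('a::chilbert_space \<Rightarrow>\<^sub>L 'a) \<Rightarrow> real" where
  "dw S = (if {x::'a. norm x = 1} = {} then 0
     else SUP x\<in>{x::'a. norm x = 1}.
       sqrt ((cmod (cinner (blinfun_apply S x) x))\<^sup>2 + norm (blinfun_apply S x) ^ 4))"

end

theory Submission
  imports Defs "HOL-Computational_Algebra.Fundamental_Theorem_Algebra"
begin

text \<open>For a unit vector \<open>x\<close>, the convexity of \<open>t powr (r / 2)\<close> splits \<open>|\<langle>Sx,x\<rangle>|\<^sup>2 + \<parallel>Sx\<parallel>\<^sup>4\<close> into the
  powers \<open>|\<langle>Tx,x\<rangle>|\<^sup>r\<close> for \<open>T = S\<close> and \<open>T = S\<^sup>*S\<close>. Each of them is bounded by the mixed Schwarz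
  inequality \<open>|\<langle>Tx,x\<rangle>|\<^sup>2 \<le> \<langle>|T| powr (2\<alpha>) x,x\<rangle> \<langle>|T\<^sup>*| powr (2(1-\<alpha>)) x,x\<rangle>\<close>, the arithmetic-geometric
  mean inequality and McCarthy's inequality \<open>\<langle>Ax,x\<rangle> powr r \<le> \<langle>A powr r x,x\<rangle>\<close>. The functional
  calculus rests on the bound of \<open>\<parallel>p(A)\<parallel>\<close> by the supremum of \<open>|p|\<close> on the spectrum, for which it is
  enough to factor the real polynomial \<open>\<parallel>p(A)\<parallel>\<^sup>2 - p\<^sup>2\<close>: it must have a root in the spectrum.\<close>

instance chilbert_space \<subseteq> banach ..

section \<open>Complex inner products\<close>

lemma cinner_add_right: "cinner x (y + z) = cinner x y + cinner x (z::'a::complex_inner)"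
  by (metis cinner_add_left cinner_commute complex_cnj_add)

lemma cinner_scaleC_right: "cinner x (a *\<^sub>C y) = cnj a * cinner x (y::'a::complex_inner)"
  by (metis cinner_commute cinner_scaleC_left complex_cnj_mult)

lemma cinner_scaleR_left: "cinner (r *\<^sub>R x) y = of_real r * cinner x (y::'a::complex_inner)"
  by (metis cinner_scaleC_left scaleC_of_real)

lemma cinner_scaleR_right: "cinner x (r *\<^sub>R y) = of_real r * cinner x (y::'a::complex_inner)"
  by (metis cinner_scaleC_right scaleC_of_real complex_cnj_complex_of_real)

lemma cinner_diff_left: "cinner (x - y) z = cinner x z - cinner y (z::'a::complex_inner)"
  using cinner_add_left[of "x - y" y z] by simp

lemma cinner_diff_right: "cinner z (x - y) = cinner z x - cinner z (y::'a::complex_inner)"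
  using cinner_add_right[of z "x - y" y] by simp

lemma cinner_zero_left [simp]: "cinner 0 (x::'a::complex_inner) = 0"
  using cinner_scaleR_left[of 0 0 x] by simp

lemma cinner_zero_right [simp]: "cinner (x::'a::complex_inner) 0 = 0"
  using cinner_scaleR_right[of x 0 0] by simp

lemma Re_cinner_self: "Re (cinner x x) = (norm (x::'a::complex_inner))\<^sup>2"
  by (simp add: norm_eq_sqrt_cinner cinner_ge_zero)

lemma Re_cinner_commute: "Re (cinner x y) = Re (cinner y (x::'a::complex_inner))"
  by (metis cinner_commute complex_cnj_cnj complex.sel(1) cnj.simps(1))

lemma norm_scaleC: "norm (a *\<^sub>C x) = cmod a * norm (x::'a::complex_inner)"
proof -
  have "cinner (a *\<^sub>C x) (a *\<^sub>C x) = of_real ((cmod a)\<^sup>2) * cinner x x"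
    by (simp add: cinner_scaleC_left cinner_scaleC_right complex_norm_square mult.assoc mult.left_commute
        flip: of_real_power)
  then have "(norm (a *\<^sub>C x))\<^sup>2 = (cmod a * norm x)\<^sup>2"
    by (simp add: power_mult_distrib flip: Re_cinner_self)
  then show ?thesis by simp
qed

lemma norm_diff_sq:
  "(norm (x - y))\<^sup>2 = (norm x)\<^sup>2 - 2 * Re (cinner x y) + (norm (y::'a::complex_inner))\<^sup>2"
  using Re_cinner_commute[of x y]
  by (simp add: cinner_diff_left cinner_diff_right flip: Re_cinner_self)

text \<open>For unit vectors this is the nonnegativity of the squared norm of \<open>u - v\<close>;
  the general case follows by scaling.\<close>

lemma Re_cinner_le: "Re (cinner x y) \<le> norm x * norm (y::'a::complex_inner)"
proof (cases "x = 0 \<or> y = 0")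
  case False
  define u v where "u = x /\<^sub>R norm x" and "v = y /\<^sub>R norm y"
  have "norm u = 1" "norm v = 1"
    using False by (auto simp: u_def v_def)
  then have "0 \<le> 2 - 2 * Re (cinner u v)"
    using norm_diff_sq[of u v] zero_le_power2[of "norm (u - v)"] by simp
  moreover have "Re (cinner u v) = Re (cinner x y) / (norm x * norm y)"
    by (simp add: u_def v_def cinner_scaleR_left cinner_scaleR_right field_simps
        flip: of_real_inverse)
  ultimately show ?thesis
    using False by (simp add: field_simps)
qed auto

lemma cmod_cinner_le: "cmod (cinner x y) \<le> norm x * norm (y::'a::complex_inner)"
proof (cases "cinner x y = 0")
  case False
  \<comment> \<open>This unimodular factor rotates the inner product onto the nonnegative real axis,
    where the bound on real parts applies.\<close>
  define c where "c = cnj (sgn (cinner x y))"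
  have c: "cmod c = 1"
    using False by (simp add: c_def norm_sgn)
  have "cinner (c *\<^sub>C x) y = of_real (cmod (cinner x y))"
    using False
    by (simp add: c_def cinner_scaleC_left sgn_eq complex_norm_square[symmetric] mult.commute
        power2_eq_square[of "complex_of_real (cmod (cinner x y))"])
  then have "cmod (cinner x y) = Re (cinner (c *\<^sub>C x) y)" by simp
  also have "\<dots> \<le> norm x * norm y"
    using Re_cinner_le[of "c *\<^sub>C x" y] by (simp add: norm_scaleC c)
  finally show ?thesis .
qed auto

lemma bounded_bilinear_cinner: "bounded_bilinear (cinner :: 'a::complex_inner \<Rightarrow> _)"
proof
  show "\<exists>K. \<forall>a b::'a. norm (cinner a b) \<le> norm a * norm b * K"
    by (rule exI[of _ 1]) (simp add: cmod_cinner_le)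
qed (auto simp: cinner_add_left cinner_add_right cinner_scaleR_left cinner_scaleR_right scaleR_conv_of_real)

text \<open>Over the real scalars this form is a real inner product; the representation theorems
  below are applied to it.\<close>

lemma bounded_bilinear_Re_cinner: "bounded_bilinear (\<lambda>x y::'a::complex_inner. Re (cinner x y))"
proof
  show "\<exists>K. \<forall>a b::'a. norm (Re (cinner a b)) \<le> norm a * norm b * K"
    by (rule exI[of _ 1]) (auto intro: order_trans[OF abs_Re_le_cmod cmod_cinner_le])
qed (auto simp: cinner_add_left cinner_add_right cinner_scaleR_left cinner_scaleR_right)

text \<open>Testing with \<open>h = x - y\<close> leaves the squared norm of the difference.\<close>

lemma eq_if_Re_cinner_eq:
  assumes "\<And>h. Re (cinner x h) = Re (cinner y (h::'a::complex_inner))"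
  shows "x = y"
  using assms[of "x - y"] Re_cinner_self[of "x - y"] by (simp add: cinner_diff_left)

section \<open>The symmetric Lax--Milgram theorem\<close>

text \<open>Near \<open>t = 0\<close> a nonzero linear term would dominate and take both signs. The
  choice \<open>t = - b / d\<close> with \<open>d > \<bar>a\<bar>\<close> makes the sum negative
  without a limit, whatever the sign of \<open>a\<close>.\<close>

lemma nonneg_quadratic_imp_linear_zero:
  fixes a b :: real
  assumes "\<And>t. 0 \<le> t\<^sup>2 * a + t * b"
  shows "b = 0"
proof (rule ccontr)
  assume "b \<noteq> 0"
  define d where "d = \<bar>a\<bar> + 1"
  have d: "d > 0" "a < d" by (auto simp: d_def)
  have "0 \<le> (- b / d)\<^sup>2 * a + (- b / d) * b" by (rule assms)
  also have "\<dots> = (b\<^sup>2 / d\<^sup>2) * (a - d)"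
    using d by (simp add: field_simps power2_eq_square)
  also have "\<dots> < 0"
    using d \<open>b \<noteq> 0\<close> by (intro mult_pos_neg) auto
  finally show False by simp
qed

text \<open>The solution is the minimiser of the energy \<open>B x x - 2 f x\<close>; coercivity and the
  parallelogram law make every minimising sequence Cauchy.\<close>

lemma symmetric_Lax_Milgram:
  fixes B :: "'a::banach \<Rightarrow> 'a \<Rightarrow> real"
  assumes bil: "bounded_bilinear B" and sym: "\<And>x y. B x y = B y x"
    and c: "c > 0" and coer: "\<And>x. c * (norm x)\<^sup>2 \<le> B x x"
    and lin: "bounded_linear f"
  shows "\<exists>b. \<forall>h. B b h = f h"
proof -
  interpret B: bounded_bilinear B by fact
  interpret f: bounded_linear f by fact
  define F where "F = (\<lambda>x. B x x - 2 * f x)"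
  obtain K where K: "\<And>x. norm (f x) \<le> norm x * K" using f.bounded by blast
  \<comment> \<open>Completing the square in \<open>norm x\<close> bounds the energy from below, so
    its infimum is finite.\<close>
  have "- (K\<^sup>2 / c) \<le> F x" for x
  proof -
    have "0 \<le> (c * norm x - K)\<^sup>2 / c" using c by simp
    also have "\<dots> = c * (norm x)\<^sup>2 - 2 * (norm x * K) + K\<^sup>2 / c"
      using c by (simp add: field_simps power2_eq_square)
    finally show ?thesis
      using coer[of x] K[of x] unfolding F_def by simp
  qed
  then have bdd: "bdd_below (range F)" by (auto intro!: bdd_belowI)
  define m where "m = Inf (range F)"
  have m: "m \<le> F x" for x
    unfolding m_def by (rule cInf_lower) (use bdd in auto)
  have "\<exists>x. F x < m + 1 / Suc n" for n
    using cInf_lessD[of "range F" "m + 1 / Suc n"] unfolding m_def by auto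
  then obtain X where X: "\<And>n. F (X n) < m + 1 / Suc n" by metis
  \<comment> \<open>The energy at the midpoint is at least \<open>m\<close>; the parallelogram
    identity then bounds the distance by the two excesses over \<open>m\<close>.\<close>
  have par: "c * (norm (x - y))\<^sup>2 \<le> 2 * (F x - m) + 2 * (F y - m)" for x y
  proof -
    have "c * (norm (x - y))\<^sup>2 \<le> B (x - y) (x - y)" by (rule coer)
    also have "\<dots> = 2 * F x + 2 * F y - 4 * F ((1/2) *\<^sub>R (x + y))"
      by (simp add: F_def B.diff_left B.diff_right B.add_left B.add_right B.scaleR_left
          B.scaleR_right f.add f.scaleR sym[of y x] algebra_simps)
    finally show ?thesis using m[of "(1/2) *\<^sub>R (x + y)"] by simp
  qed
  have "Cauchy X"
  proof (rule CauchyI)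
    fix e :: real assume e: "0 < e"
    obtain N where N: "1 / Suc N < c * e\<^sup>2 / 4"
      using nat_approx_posE[of "c * e\<^sup>2 / 4"] e c by auto
    have "norm (X k - X n) < e" if "k \<ge> N" "n \<ge> N" for k n
    proof -
      have le: "F (X j) - m < c * e\<^sup>2 / 4" if "j \<ge> N" for j
      proof -
        have "1 / real (Suc j) \<le> 1 / Suc N" using that by (simp add: frac_le)
        then show ?thesis using X[of j] N by linarith
      qed
      have "u < x" if "u \<le> 2 * v + 2 * w" "v < x / 4" "w < x / 4" for u v w x :: real
        using that by linarith
      from this[OF par le[OF that(1)] le[OF that(2)]]
      have "c * (norm (X k - X n))\<^sup>2 < c * e\<^sup>2" .
      then have "(norm (X k - X n))\<^sup>2 < e\<^sup>2" using c by simp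
      then show ?thesis using e by (simp add: power2_less_imp_less)
    qed
    then show "\<exists>M. \<forall>m\<ge>M. \<forall>n\<ge>M. norm (X m - X n) < e" by blast
  qed
  then obtain b where b: "X \<longlonglongrightarrow> b" using Cauchy_convergent convergent_def by blast
  have lim: "(\<lambda>n. F (X n)) \<longlonglongrightarrow> F b"
    unfolding F_def by (intro tendsto_intros B.tendsto f.tendsto b)
  have "(\<lambda>n. m + 1 / Suc n) \<longlonglongrightarrow> m + 0"
    by (intro tendsto_intros LIMSEQ_Suc lim_1_over_n)
  then have "F b \<le> m"
    using lim X by (intro LIMSEQ_le[OF lim]) (auto intro: less_imp_le)
  have "B b h = f h" for h
  proof -
    \<comment> \<open>Varying the minimiser along \<open>h\<close> gives a quadratic in
      \<open>t\<close> that is never negative, so its linear coefficient vanishes.\<close>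
    have "0 \<le> t\<^sup>2 * B h h + t * (2 * (B b h - f h))" for t
    proof -
      have "F b \<le> F (b + t *\<^sub>R h)" using \<open>F b \<le> m\<close> m order_trans by blast
      then show ?thesis
        by (simp add: F_def B.add_left B.add_right B.scaleR_left B.scaleR_right f.add f.scaleR
            sym[of h b] algebra_simps power2_eq_square)
    qed
    then have "2 * (B b h - f h) = 0" by (rule nonneg_quadratic_imp_linear_zero)
    then show ?thesis by simp
  qed
  then show ?thesis by blast
qed

section \<open>Adjoints and self-adjoint operators\<close>

lemma adj_unique:
  fixes S B :: "'a::chilbert_space \<Rightarrow>\<^sub>L 'a"
  assumes "\<And>x y. cinner (S x) y = cinner x (B y)"
  shows "adj S = B"
  unfolding adj_def
proof (rule the_equality)
  fix C :: "'a \<Rightarrow>\<^sub>L 'a"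
  assume "\<forall>x y. cinner (S x) y = cinner x (C y)"
  then have "cinner x (C y) = cinner x (B y)" for x y using assms by simp
  then show "C = B"
    by (intro blinfun_eqI eq_if_Re_cinner_eq) (simp add: Re_cinner_commute)
qed (use assms in auto)

text \<open>Representing the real functional \<open>h \<mapsto> Re (cinner (S h) y)\<close> by a
  vector gives the value of the adjoint at \<open>y\<close>. Complex linearity of \<open>S\<close>
  then recovers the imaginary parts.\<close>

lemma adj_exists:
  fixes S :: "'a::chilbert_space \<Rightarrow>\<^sub>L 'a"
  assumes S: "clinear_op S"
  shows "\<exists>B. \<forall>x y. cinner (S x) y = cinner x (blinfun_apply B y)"
proof -
  interpret I: bounded_bilinear "\<lambda>x y::'a. Re (cinner x y)"
    by (rule bounded_bilinear_Re_cinner)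
  have "\<exists>b. \<forall>h. Re (cinner b h) = Re (cinner (S h) y)" for y
  proof (rule symmetric_Lax_Milgram[OF bounded_bilinear_Re_cinner Re_cinner_commute, where c = 1])
    show "bounded_linear (\<lambda>h. Re (cinner (S h) y))"
      using bounded_linear_compose[OF I.bounded_linear_left[of y] blinfun.bounded_linear_right[of S]] .
  qed (auto simp: Re_cinner_self)
  then obtain T where T: "\<And>y h. Re (cinner (T y) h) = Re (cinner (S h) y)" by metis
  have "bounded_linear T"
  proof (rule bounded_linear_intro[where K = "norm S"])
    show "T (x + y) = T x + T y" for x y
      by (rule eq_if_Re_cinner_eq) (simp add: T cinner_add_left cinner_add_right)
    show "T (r *\<^sub>R x) = r *\<^sub>R T x" for r x
      by (rule eq_if_Re_cinner_eq) (simp add: T cinner_scaleR_left cinner_scaleR_right)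
    fix x
    \<comment> \<open>Testing the defining identity with \<open>h = T x\<close> bounds the square of
      \<open>norm (T x)\<close>; one factor is then cancelled.\<close>
    have "(norm (T x))\<^sup>2 = Re (cinner (S (T x)) x)" by (simp add: T flip: Re_cinner_self)
    also have "\<dots> \<le> norm (S (T x)) * norm x" by (rule Re_cinner_le)
    also have "\<dots> \<le> norm S * norm (T x) * norm x"
      by (intro mult_right_mono norm_blinfun) auto
    finally have "norm (T x) * norm (T x) \<le> norm (T x) * (norm x * norm S)"
      by (simp add: power2_eq_square mult_ac)
    then show "norm (T x) \<le> norm x * norm S"
      by (cases "T x = 0") (auto simp: mult_le_cancel_left)
  qed
  then have B: "blinfun_apply (Blinfun T) = T" by (rule bounded_linear_Blinfun_apply)
  have Re: "Re (cinner (S x) y) = Re (cinner x (T y))" for x y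
    by (metis Re_cinner_commute T)
  have "Im (cinner (S x) y) = Im (cinner x (T y))" for x y
  proof -
    \<comment> \<open>Multiplication by \<open>\<i>\<close> turns the real part into minus the
      imaginary part.\<close>
    have "Re (cinner (S (\<i> *\<^sub>C x)) y) = Re (cinner (\<i> *\<^sub>C x) (T y))" by (rule Re)
    then show ?thesis using S by (simp add: clinear_op_def cinner_scaleC_left)
  qed
  with Re show ?thesis by (intro exI[of _ "Blinfun T"]) (simp add: B complex_eq_iff)
qed

lemma cinner_adj:
  fixes S :: "'a::chilbert_space \<Rightarrow>\<^sub>L 'a"
  assumes "clinear_op S"
  shows "cinner (S x) y = cinner x (adj S y)"
  using adj_exists[OF assms] adj_unique by metis

lemma cinner_adj':
  fixes S :: "'a::chilbert_space \<Rightarrow>\<^sub>L 'a"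
  assumes "clinear_op S"
  shows "cinner (adj S x) y = cinner x (S y)"
  by (metis assms cinner_adj cinner_commute)

lemma adj_adj:
  fixes S :: "'a::chilbert_space \<Rightarrow>\<^sub>L 'a"
  assumes "clinear_op S"
  shows "adj (adj S) = S"
  by (rule adj_unique) (rule cinner_adj'[OF assms])

text \<open>With \<open>S\<close> moved to the other argument, the scalar comes out of the first
  one. Self-adjoint operators are therefore complex-linear without a separate assumption.\<close>

lemma clinear_op_if_adjoint_pair:
  fixes S B :: "'a::complex_inner \<Rightarrow>\<^sub>L 'a"
  assumes "\<And>x y. cinner (S x) y = cinner x (B y)"
  shows "clinear_op S"
  unfolding clinear_op_def
  by (intro allI eq_if_Re_cinner_eq) (simp add: assms cinner_scaleC_left)

text \<open>Phrased without \<open>adj\<close>, which is a definite description and says nothing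
  unless an adjoint exists.\<close>

definition selfadj :: "('a::complex_inner \<Rightarrow>\<^sub>L 'a) \<Rightarrow> bool" where
  "selfadj A \<longleftrightarrow> (\<forall>x y. cinner (A x) y = cinner x (A y))"

definition pos_op :: "('a::complex_inner \<Rightarrow>\<^sub>L 'a) \<Rightarrow> bool" where
  "pos_op A \<longleftrightarrow> selfadj A \<and> (\<forall>x. 0 \<le> Re (cinner (A x) x))"

lemma selfadjD: "selfadj A \<Longrightarrow> cinner (A x) y = cinner x (A y)"
  by (simp add: selfadj_def)

lemma clinear_op_selfadj: "selfadj A \<Longrightarrow> clinear_op A"
  by (rule clinear_op_if_adjoint_pair) (rule selfadjD)

lemma adj_selfadj: "selfadj A \<Longrightarrow> adj A = A"
  by (rule adj_unique) (rule selfadjD)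

lemma pos_op_adj_compose:
  fixes S :: "'a::chilbert_space \<Rightarrow>\<^sub>L 'a"
  assumes "clinear_op S"
  shows "pos_op (adj S o\<^sub>L S)"
proof -
  have "cinner ((adj S o\<^sub>L S) x) y = cinner (S x) (S y)"
    "cinner x ((adj S o\<^sub>L S) y) = cinner (S x) (S y)" for x y
    using cinner_adj'[OF assms, of "S x" y] cinner_adj[OF assms, of x "S y"] by simp_all
  then show ?thesis by (simp add: pos_op_def selfadj_def Re_cinner_self)
qed

lemma clinear_op_adj:
  fixes S :: "'a::chilbert_space \<Rightarrow>\<^sub>L 'a"
  assumes "clinear_op S"
  shows "clinear_op (adj S)"
  by (rule clinear_op_if_adjoint_pair) (rule cinner_adj'[OF assms])

lemma selfadj_diff: "selfadj A \<Longrightarrow> selfadj B \<Longrightarrow> selfadj (A - B)"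
  by (simp add: selfadj_def blinfun.diff_left cinner_diff_left cinner_diff_right)

lemma selfadj_scaleR: "selfadj A \<Longrightarrow> selfadj (r *\<^sub>R A)"
  by (simp add: selfadj_def blinfun.scaleR_left cinner_scaleR_left cinner_scaleR_right)

lemma selfadj_id: "selfadj id_blinfun"
  by (simp add: selfadj_def)

section \<open>The real spectrum\<close>

abbreviation rspec :: "('a::chilbert_space \<Rightarrow>\<^sub>L 'a) \<Rightarrow> real set" where
  "rspec A \<equiv> {t. complex_of_real t \<in> op_spectrum A}"

text \<open>Surjectivity comes from the Lax--Milgram theorem for the form
  \<open>Re (cinner (A x) y)\<close>. Coercivity also bounds \<open>A\<close> from below, which
  gives injectivity and the bound \<open>1 / c\<close> for the inverse.\<close>

lemma coercive_bij:
  fixes A :: "'a::chilbert_space \<Rightarrow>\<^sub>L 'a"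
  assumes A: "selfadj A" and c: "c > 0" and coer: "\<And>x. c * (norm x)\<^sup>2 \<le> Re (cinner (A x) x)"
  obtains R where "clinear_op R" "\<And>x. blinfun_apply R (A x) = x" "\<And>x. A (R x) = x"
proof -
  interpret I: bounded_bilinear "\<lambda>x y::'a. Re (cinner x y)"
    by (rule bounded_bilinear_Re_cinner)
  have "\<exists>b. \<forall>h. Re (cinner (A b) h) = Re (cinner y h)" for y
  proof (rule symmetric_Lax_Milgram[where B = "\<lambda>x y. Re (cinner (A x) y)" and c = c])
    show "bounded_bilinear (\<lambda>x y. Re (cinner (A x) y))"
      by (rule I.comp1) (rule blinfun.bounded_linear_right)
    show "Re (cinner (A x) y) = Re (cinner (A y) x)" for x y
      using Re_cinner_commute[of "A x" y] by (simp add: selfadjD[OF A])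
    show "bounded_linear (\<lambda>h. Re (cinner y h))" by (rule I.bounded_linear_right)
  qed (use c coer in auto)
  then have "\<exists>b. A b = y" for y by (blast intro: eq_if_Re_cinner_eq)
  then obtain R where R: "\<And>y. A (R y) = y" by metis
  have below: "c * norm x \<le> norm (A x)" for x
  proof -
    have "c * norm x * norm x \<le> norm (A x) * norm x"
      using coer[of x] Re_cinner_le[of "A x" x] by (simp add: power2_eq_square)
    then show ?thesis using c by (cases "x = 0") auto
  qed
  have inj: "x = y" if "A x = A y" for x y
    using below[of "x - y"] that c by (simp add: blinfun.diff_right mult_le_0_iff)
  have "bounded_linear R"
  proof (rule bounded_linear_intro[where K = "1 / c"])
    show "R (x + y) = R x + R y" for x y by (rule inj) (simp add: R blinfun.add_right)
    show "R (r *\<^sub>R x) = r *\<^sub>R R x" for r x by (rule inj) (simp add: R blinfun.scaleR_right)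
    show "norm (R x) \<le> norm x * (1 / c)" for x
      using below[of "R x"] c by (simp add: R field_simps)
  qed
  then have B: "blinfun_apply (Blinfun R) = R" by (rule bounded_linear_Blinfun_apply)
  show thesis
  proof (rule that[of "Blinfun R"])
    have "A (c *\<^sub>C x) = c *\<^sub>C A x" for c x
      using clinear_op_selfadj[OF A] by (simp add: clinear_op_def)
    then have "R (c *\<^sub>C x) = c *\<^sub>C R x" for c x by (intro inj[of "R (c *\<^sub>C x)"]) (simp add: R)
    then show "clinear_op (Blinfun R)" by (simp add: clinear_op_def B)
    show "Blinfun R (A x) = x" for x by (rule inj) (simp add: B R)
    show "A (Blinfun R x) = x" for x by (simp add: B R)
  qed
qed

text \<open>The factor \<open>s\<close> carries a sign, so that one statement covers points on
  either side of the numerical range. If \<open>R\<close> inverts \<open>s (A - t)\<close>, then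
  \<open>s R\<close> inverts \<open>A - t\<close>.\<close>

lemma not_in_rspec_if:
  fixes A :: "'a::chilbert_space \<Rightarrow>\<^sub>L 'a"
  assumes A: "selfadj A" and s: "s \<noteq> 0" and c: "c > 0"
    and coer: "\<And>x. c * (norm x)\<^sup>2 \<le> s * (Re (cinner (A x) x) - t * (norm x)\<^sup>2)"
  shows "t \<notin> rspec A"
proof -
  have "selfadj (s *\<^sub>R (A - t *\<^sub>R id_blinfun))"
    by (intro selfadj_scaleR selfadj_diff A selfadj_id)
  moreover have "c * (norm x)\<^sup>2 \<le> Re (cinner ((s *\<^sub>R (A - t *\<^sub>R id_blinfun)) x) x)" for x
    using coer[of x]
    by (simp add: blinfun.diff_left blinfun.scaleR_left cinner_scaleR_left cinner_diff_left
        Re_cinner_self)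
  ultimately obtain R where R: "clinear_op R"
    "\<And>x. blinfun_apply R ((s *\<^sub>R (A - t *\<^sub>R id_blinfun)) x) = x"
    "\<And>x. (s *\<^sub>R (A - t *\<^sub>R id_blinfun)) (R x) = x"
    using coercive_bij[OF _ c] by blast
  have "clinear_op (s *\<^sub>R R)"
    using R(1) by (simp add: clinear_op_def blinfun.scaleR_left scaleC_scaleC mult.commute
        flip: scaleC_of_real)
  moreover have "(s *\<^sub>R R) (A x - of_real t *\<^sub>C x) = x" for x
    using R(2)[of x] by (simp add: scaleC_of_real blinfun.diff_left blinfun.scaleR_left
        blinfun.scaleR_right)
  moreover have "A ((s *\<^sub>R R) x) - of_real t *\<^sub>C ((s *\<^sub>R R) x) = x" for x
    using R(3)[of x] by (simp add: scaleC_of_real blinfun.diff_left blinfun.scaleR_left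
        blinfun.scaleR_right scaleR_diff_right mult.commute)
  ultimately show ?thesis unfolding op_spectrum_def by blast
qed

text \<open>For \<open>t\<close> below \<open>0\<close> the form of \<open>A - t\<close> is coercive
  by positivity; for \<open>t\<close> above \<open>norm A\<close> that of \<open>t - A\<close> is,
  by the Schwarz inequality.\<close>

lemma rspec_pos_op:
  fixes A :: "'a::chilbert_space \<Rightarrow>\<^sub>L 'a"
  assumes "pos_op A"
  shows "rspec A \<subseteq> {0..norm A}"
proof
  fix t assume t: "t \<in> rspec A"
  have A: "selfadj A" "\<And>x. 0 \<le> Re (cinner (A x) x)" using assms by (auto simp: pos_op_def)
  have "t \<ge> 0"
  proof (rule ccontr)
    assume "\<not> t \<ge> 0"
    then have "t \<notin> rspec A"
      using A(2) by (intro not_in_rspec_if[OF A(1), of 1 "-t"]) auto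
    with t show False by simp
  qed
  moreover have "t \<le> norm A"
  proof (rule ccontr)
    assume *: "\<not> t \<le> norm A"
    have "Re (cinner (A x) x) \<le> norm A * (norm x)\<^sup>2" for x
      using Re_cinner_le[of "A x" x] mult_right_mono[OF norm_blinfun[of A x], of "norm x"]
      by (simp add: power2_eq_square mult.assoc)
    then have "t \<notin> rspec A"
      using * by (intro not_in_rspec_if[OF A(1), of "-1" "t - norm A"]) (auto simp: algebra_simps)
    with t show False by simp
  qed
  ultimately show "t \<in> {0..norm A}" by simp
qed

section \<open>Polynomials of an operator\<close>

lemmas compose_bilinear_simps =
  bounded_bilinear.add_left[OF bounded_bilinear_blinfun_compose]
  bounded_bilinear.add_right[OF bounded_bilinear_blinfun_compose]
  bounded_bilinear.scaleR_left[OF bounded_bilinear_blinfun_compose]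
  bounded_bilinear.scaleR_right[OF bounded_bilinear_blinfun_compose]

lemma blinfun_compose_assoc': "(A o\<^sub>L B) o\<^sub>L C = A o\<^sub>L (B o\<^sub>L C)"
  by (rule blinfun_eqI) simp

lemma op_poly_0 [simp]: "op_poly 0 A = 0"
  by (simp add: op_poly_def)

text \<open>Horner's rule. It opens the way to induction on polynomials, so that the sum in the
  definition need not be touched again.\<close>

lemma op_poly_pCons: "op_poly (pCons a p) A = a *\<^sub>R id_blinfun + (A o\<^sub>L op_poly p A)"
proof (cases "p = 0")
  case True
  then show ?thesis by (simp add: op_poly_def)
next
  case False
  have "op_poly (pCons a p) A = a *\<^sub>R id_blinfun +
      (\<Sum>i\<le>degree p. coeff p i *\<^sub>R (A o\<^sub>L ((\<lambda>B. A o\<^sub>L B) ^^ i) id_blinfun))"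
    using False by (simp add: op_poly_def sum.atMost_Suc_shift del: sum.atMost_Suc)
  then show ?thesis
    by (simp add: op_poly_def bounded_bilinear.sum_right[OF bounded_bilinear_blinfun_compose]
        compose_bilinear_simps)
qed

lemma op_poly_const: "op_poly [:a:] A = a *\<^sub>R id_blinfun"
  by (simp add: op_poly_pCons)

lemma op_poly_id: "op_poly [:0, 1:] A = A"
  by (rule blinfun_eqI) (simp add: op_poly_pCons)

lemma op_poly_linear: "op_poly [:a, b:] A = a *\<^sub>R id_blinfun + b *\<^sub>R A"
  by (rule blinfun_eqI) (simp add: op_poly_pCons blinfun.bilinear_simps)

lemma op_poly_add: "op_poly (p + q) A = op_poly p A + op_poly q A"
  by (induction p q rule: poly_induct2)
    (simp_all add: op_poly_pCons scaleR_add_left compose_bilinear_simps)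

lemma op_poly_smult: "op_poly (smult c p) A = c *\<^sub>R op_poly p A"
  by (induction p) (simp_all add: op_poly_pCons scaleR_add_right compose_bilinear_simps)

lemma op_poly_diff: "op_poly (p - q) A = op_poly p A - op_poly q A"
  using op_poly_add[of p "smult (-1) q" A] by (simp only: op_poly_smult) simp

lemma op_poly_mult: "op_poly (p * q) A = op_poly p A o\<^sub>L op_poly q A"
  by (induction p)
    (simp_all add: op_poly_pCons op_poly_add op_poly_smult mult_pCons_left compose_bilinear_simps
      blinfun_compose_assoc' blinfun_eqI)

text \<open>With \<open>S = A = B\<close> an operator commutes with its own polynomials; later the
  rule carries the calculus of \<open>adj S o\<^sub>L S\<close> over to
  \<open>S o\<^sub>L adj S\<close>.\<close>

lemma op_poly_intertwine:
  assumes "S o\<^sub>L A = B o\<^sub>L S"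
  shows "S o\<^sub>L op_poly p A = op_poly p B o\<^sub>L S"
proof (induction p)
  case (pCons a p)
  have "S (A x) = B (S x)" for x using arg_cong[OF assms, of "\<lambda>T. T x"] by simp
  moreover have "S (op_poly p A x) = op_poly p B (S x)" for x
    using arg_cong[OF pCons(2), of "\<lambda>T. T x"] by simp
  ultimately show ?case
    by (intro blinfun_eqI) (simp add: op_poly_pCons blinfun.bilinear_simps)
qed simp

lemma selfadj_op_poly:
  assumes A: "selfadj A"
  shows "selfadj (op_poly p A)"
proof (induction p)
  case (pCons a p)
  have "A (op_poly p A y) = op_poly p A (A y)" for y
    using arg_cong[OF op_poly_intertwine[of A A A p], of "\<lambda>T. T y"] by simp
  then show ?case
    using selfadjD[OF A] selfadjD[OF pCons(2)]
    by (simp add: selfadj_def op_poly_pCons blinfun.bilinear_simps cinner_add_left cinner_add_right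
        cinner_scaleR_left cinner_scaleR_right)
qed (simp add: selfadj_def)

section \<open>Spectral bound for the norm\<close>

text \<open>Stands in for invertibility in the spectral argument: it passes to products, and a left
  inverse is enough to establish it.\<close>

definition bounded_below :: "('a::real_normed_vector \<Rightarrow>\<^sub>L 'a) \<Rightarrow> bool" where
  "bounded_below T \<longleftrightarrow> (\<exists>c>0. \<forall>x. c * norm x \<le> norm (T x))"

lemma bounded_below_compose:
  assumes "bounded_below S" "bounded_below T"
  shows "bounded_below (S o\<^sub>L T)"
proof -
  obtain c d where c: "c > 0" "\<And>x. c * norm x \<le> norm (S x)"
    and d: "d > 0" "\<And>x. d * norm x \<le> norm (T x)"
    using assms unfolding bounded_below_def by blast
  have "c * d * norm x \<le> norm (S (T x))" for x
  proof -
    have "c * d * norm x = c * (d * norm x)" by simp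
    also have "\<dots> \<le> c * norm (T x)" using c(1) d(2) by (intro mult_left_mono) auto
    also have "\<dots> \<le> norm (S (T x))" by (rule c(2))
    finally show ?thesis .
  qed
  with c(1) d(1) show ?thesis
    unfolding bounded_below_def by (intro exI[of _ "c * d"]) simp
qed

lemma bounded_below_if_not_in_rspec:
  assumes "t \<notin> rspec A"
  shows "bounded_below (op_poly [:- t, 1:] A)"
proof -
  obtain R :: "'a \<Rightarrow>\<^sub>L 'a" where R: "\<And>x. R (A x - of_real t *\<^sub>C x) = x"
    using assms unfolding op_spectrum_def by blast
  \<comment> \<open>The summand 1 keeps \<open>k\<close> positive even if \<open>R = 0\<close>, as
    on the zero space.\<close>
  define k where "k = norm R + 1"
  have k: "k > 0" by (simp add: k_def add_nonneg_pos)
  have "1 / k * norm x \<le> norm (op_poly [:- t, 1:] A x)" for x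
  proof -
    have "norm x = norm (R (op_poly [:- t, 1:] A x))"
      using R[of x] by (simp add: op_poly_linear blinfun.bilinear_simps scaleC_of_real)
    also have "\<dots> \<le> norm R * norm (op_poly [:- t, 1:] A x)" by (rule norm_blinfun)
    also have "\<dots> \<le> k * norm (op_poly [:- t, 1:] A x)"
      by (intro mult_right_mono) (auto simp: k_def)
    finally show ?thesis using k by (simp add: pos_divide_le_eq mult.commute)
  qed
  moreover have "0 < 1 / k" using k by simp
  ultimately show ?thesis unfolding bounded_below_def by blast
qed

text \<open>The operator is \<open>(A - a)\<^sup>2 + b\<^sup>2\<close>, whose form is at least
  \<open>b\<^sup>2 * (norm x)\<^sup>2\<close>. Factors with a pair of nonreal roots are thus
  harmless whatever the spectrum is.\<close>

lemma bounded_below_quadratic: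
  fixes A :: "'a::chilbert_space \<Rightarrow>\<^sub>L 'a"
  assumes A: "selfadj A" and b: "b \<noteq> 0"
  shows "bounded_below (op_poly [:a\<^sup>2 + b\<^sup>2, - 2 * a, 1:] A)"
proof -
  let ?Q = "op_poly [:a\<^sup>2 + b\<^sup>2, - 2 * a, 1:] A" and ?L = "op_poly [:- a, 1:] A"
  have "[:a\<^sup>2 + b\<^sup>2, - 2 * a, 1:] = [:- a, 1:] * [:- a, 1:] + [:b\<^sup>2:]"
    by (simp add: power2_eq_square)
  then have Q: "?Q x = ?L (?L x) + b\<^sup>2 *\<^sub>R x" for x
    by (simp only: op_poly_add op_poly_mult op_poly_const) (simp add: blinfun.bilinear_simps)
  have "b\<^sup>2 * norm x \<le> norm (?Q x)" for x
  proof -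
    have "b\<^sup>2 * (norm x)\<^sup>2 \<le> (norm (?L x))\<^sup>2 + b\<^sup>2 * (norm x)\<^sup>2" by simp
    also have "\<dots> = Re (cinner (?Q x) x)"
      using selfadjD[OF selfadj_op_poly[OF A], of "[:- a, 1:]" "?L x" x]
      by (simp only: Q cinner_add_left cinner_scaleR_left)
        (simp add: Re_cinner_self del: of_real_power flip: of_real_power)
    also have "\<dots> \<le> norm (?Q x) * norm x" by (rule Re_cinner_le)
    finally have "b\<^sup>2 * norm x * norm x \<le> norm (?Q x) * norm x" by (simp add: power2_eq_square)
    then show ?thesis by (cases "x = 0") auto
  qed
  with b show ?thesis unfolding bounded_below_def by (intro exI[of _ "b\<^sup>2"]) simp
qed

section \<open>Factoring real polynomials by their complex roots\<close>

lemma poly_of_real_pCons: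
  "poly (map_poly complex_of_real (pCons a p)) z = of_real a + z * poly (map_poly of_real p) z"
  by (simp add: map_poly_pCons)

lemma poly_of_real_add:
  "poly (map_poly complex_of_real (p + q)) z =
    poly (map_poly of_real p) z + poly (map_poly of_real q) z"
  by (induction p q rule: poly_induct2) (simp_all add: poly_of_real_pCons algebra_simps)

lemma poly_of_real_smult:
  "poly (map_poly complex_of_real (smult c p)) z = of_real c * poly (map_poly of_real p) z"
  by (induction p) (simp_all add: poly_of_real_pCons algebra_simps)

lemma poly_of_real_mult:
  "poly (map_poly complex_of_real (p * q)) z =
    poly (map_poly of_real p) z * poly (map_poly of_real q) z"
  by (induction p)
    (simp_all add: poly_of_real_pCons poly_of_real_add poly_of_real_smult mult_pCons_left
      algebra_simps)

lemma real_poly_factor: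
  fixes p :: "real poly"
  assumes "degree p > 0"
  obtains t where "[:- t, 1:] dvd p" | a b where "b \<noteq> 0" "[:a\<^sup>2 + b\<^sup>2, - 2 * a, 1:] dvd p"
proof -
  have deg: "degree (map_poly complex_of_real p) = degree p" by (rule degree_map_poly) simp
  have "\<not> constant (poly (map_poly complex_of_real p))"
    using assms by (simp add: constant_degree deg)
  then obtain z where z: "poly (map_poly complex_of_real p) z = 0"
    using fundamental_theorem_of_algebra by blast
  show thesis
  proof (cases "Im z = 0")
    case True
    then have "z = of_real (Re z)" by (simp add: complex_eq_iff)
    then have "poly (map_poly complex_of_real p) (of_real (Re z)) = 0" using z by simp
    moreover have "poly (map_poly complex_of_real p) (of_real t) = of_real (poly p t)" for t
      by (induction p) (simp_all add: poly_of_real_pCons)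
    ultimately have "poly p (Re z) = 0" by simp
    then show thesis by (intro that(1)[of "Re z"]) (simp add: poly_eq_0_iff_dvd)
  next
    case False
    define d where "d = [:(Re z)\<^sup>2 + (Im z)\<^sup>2, - 2 * Re z, 1:]"
    have dz: "poly (map_poly complex_of_real d) z = 0"
      by (simp add: d_def poly_of_real_pCons complex_eq_iff power2_eq_square algebra_simps)
    \<comment> \<open>The remainder is at most linear, has real coefficients and vanishes at a
      nonreal point, so it is zero.\<close>
    define q where "q = p mod d"
    have "p = p div d * d + q" by (simp add: q_def)
    then have "poly (map_poly complex_of_real q) z = 0"
      using z dz by (metis add.left_neutral mult_zero_right poly_of_real_add poly_of_real_mult)
    moreover have "degree q < 2"
      using degree_mod_less[of d p] by (auto simp: q_def d_def)
    then have "q = [:coeff q 0, coeff q 1:]"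
      by (intro poly_eqI) (auto simp: coeff_pCons coeff_eq_0 split: nat.splits)
    then obtain u v where q: "q = [:u, v:]" by blast
    ultimately have "complex_of_real u + z * of_real v = 0"
      by (simp add: poly_of_real_pCons)
    then have "v = 0" "u = 0" using False by (auto simp: complex_eq_iff)
    then have "d dvd p" using q by (simp add: q_def mod_eq_0_iff_dvd)
    then show thesis using False by (intro that(2)[of "Im z" "Re z"]) (auto simp: d_def)
  qed
qed

text \<open>Strong induction on the degree, splitting off one real factor at a time: a linear factor
  has its root outside the spectrum, a quadratic one is always bounded below.\<close>

lemma op_poly_bounded_below:
  fixes A :: "'a::chilbert_space \<Rightarrow>\<^sub>L 'a"
  assumes A: "selfadj A"
  shows "p \<noteq> 0 \<Longrightarrow> (\<And>t. t \<in> rspec A \<Longrightarrow> poly p t \<noteq> 0) \<Longrightarrow> bounded_below (op_poly p A)"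
proof (induction "degree p" arbitrary: p rule: less_induct)
  case less
  have factor: "bounded_below (op_poly p A)"
    if d: "d dvd p" "degree d > 0" "bounded_below (op_poly d A)" for d
  proof -
    obtain q where q: "p = d * q" using d(1) by blast
    with less.prems have "q \<noteq> 0" "d \<noteq> 0" by auto
    with q d(2) have "degree q < degree p" by (simp add: degree_mult_eq)
    then have "bounded_below (op_poly q A)"
      using less.prems q \<open>q \<noteq> 0\<close> by (intro less.hyps) auto
    with d(3) show ?thesis unfolding q op_poly_mult by (intro bounded_below_compose)
  qed
  show ?case
  proof (cases "degree p > 0")
    case True
    then show ?thesis
    proof (cases rule: real_poly_factor)
      case (1 t)
      then have "poly p t = 0" by (simp add: poly_eq_0_iff_dvd)
      then have "t \<notin> rspec A" using less.prems(2) by blast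
      with 1 show ?thesis by (intro factor[OF 1] bounded_below_if_not_in_rspec) auto
    next
      case (2 b a)
      then show ?thesis by (intro factor[OF 2(2)] bounded_below_quadratic A) auto
    qed
  next
    case False
    then obtain a where a: "p = [:a:]" by (auto elim: degree_eq_zeroE)
    with less.prems show ?thesis
      unfolding bounded_below_def
      by (intro exI[of _ "\<bar>a\<bar>"]) (simp add: op_poly_const blinfun.bilinear_simps)
  qed
qed

text \<open>If \<open>norm B\<close> and \<open>- norm B\<close> were both outside the spectrum, \<open>(norm B)\<^sup>2 - B\<^sup>2\<close> would be bounded
  below, which forces \<open>norm (B x) \<le> k * norm x\<close> with \<open>k < norm B\<close>.\<close>

lemma not_bounded_below_norm_sq:
  fixes B :: "'a::chilbert_space \<Rightarrow>\<^sub>L 'a"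
  assumes B: "selfadj B" and M: "norm B > 0"
    and below: "bounded_below ((norm B)\<^sup>2 *\<^sub>R id_blinfun - (B o\<^sub>L B))"
  shows False
proof -
  define M where "M = norm B"
  have M0: "M > 0" using M by (simp add: M_def)
  have "\<exists>c>0. \<forall>x. c * norm x \<le> norm (M\<^sup>2 *\<^sub>R x - B (B x))"
    using below by (simp add: bounded_below_def M_def blinfun.diff_left blinfun.scaleR_left)
  then obtain c where c: "c > 0" "\<And>x. c * norm x \<le> norm (M\<^sup>2 *\<^sub>R x - B (B x))"
    by blast
  \<comment> \<open>This constant results from squaring the lower bound, expanding, and estimating
    \<open>norm (B (B x))\<close> by \<open>M * norm (B x)\<close>.\<close>
  define k where "k = M\<^sup>2 - c\<^sup>2 / M\<^sup>2"
  have le: "(norm (B x))\<^sup>2 \<le> k * (norm x)\<^sup>2" for x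
  proof -
    have cross: "Re (cinner x (B (B x))) = (norm (B x))\<^sup>2"
      using selfadjD[OF B, of x "B x"] Re_cinner_self[of "B x"] by simp
    have "c\<^sup>2 * (norm x)\<^sup>2 = (c * norm x)\<^sup>2" by (simp add: power_mult_distrib)
    also have "\<dots> \<le> (norm (M\<^sup>2 *\<^sub>R x - B (B x)))\<^sup>2"
      using c by (intro power_mono) auto
    also have "\<dots> = M^4 * (norm x)\<^sup>2 - 2 * M\<^sup>2 * (norm (B x))\<^sup>2 + (norm (B (B x)))\<^sup>2"
      by (simp add: norm_diff_sq cinner_scaleR_left power_mult_distrib cross flip: power_mult)
    also have "\<dots> \<le> M^4 * (norm x)\<^sup>2 - M\<^sup>2 * (norm (B x))\<^sup>2"
      using power_mono[OF norm_blinfun[of B "B x"], of 2] by (simp add: M_def power_mult_distrib)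
    finally have "M\<^sup>2 * (norm (B x))\<^sup>2 \<le> M^4 * (norm x)\<^sup>2 - c\<^sup>2 * (norm x)\<^sup>2" by simp
    then show ?thesis using M0 by (simp add: k_def field_simps flip: power_add)
  qed
  have "norm (B x) \<le> sqrt (max 0 k) * norm x" for x
  proof -
    have "(norm (B x))\<^sup>2 \<le> max 0 k * (norm x)\<^sup>2"
      using order_trans[OF le mult_right_mono[of k "max 0 k"]] by simp
    also have "\<dots> = (sqrt (max 0 k) * norm x)\<^sup>2" by (simp add: power_mult_distrib)
    finally show ?thesis by (rule power2_le_imp_le) simp
  qed
  then have "M \<le> sqrt (max 0 k)"
    unfolding M_def by (intro norm_blinfun_bound) auto
  then have "M\<^sup>2 \<le> max 0 k" using M0 by (metis less_imp_le max.cobounded1 power_mono real_sqrt_pow2)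
  moreover have "k < M\<^sup>2" using c M0 by (simp add: k_def)
  ultimately show False
    using zero_less_power[OF M0, of 2] by (simp add: max_def split: if_splits)
qed

text \<open>A norm above \<open>m\<close> would leave
  \<open>(norm (op_poly p A))\<^sup>2 - p\<^sup>2\<close> without zeros on the spectrum, hence
  bounded below at \<open>A\<close>, against \<open>not_bounded_below_norm_sq\<close>.\<close>

lemma norm_op_poly_le:
  fixes A :: "'a::chilbert_space \<Rightarrow>\<^sub>L 'a"
  assumes A: "selfadj A" and m: "0 \<le> m" and le: "\<And>t. t \<in> rspec A \<Longrightarrow> \<bar>poly p t\<bar> \<le> m"
  shows "norm (op_poly p A) \<le> m"
proof -
  \<comment> \<open>The last condition says that the polynomial to be factored is not zero.\<close>
  have key: "norm (op_poly p A) \<le> m"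
    if "0 \<le> m" "\<And>t. t \<in> rspec A \<Longrightarrow> \<bar>poly p t\<bar> \<le> m" "[:(norm (op_poly p A))\<^sup>2:] \<noteq> p * p" for m p
  proof (rule ccontr)
    assume "\<not> ?thesis"
    then have gt: "m < norm (op_poly p A)" by simp
    define q where "q = [:(norm (op_poly p A))\<^sup>2:] - p * p"
    have "poly q t \<noteq> 0" if "t \<in> rspec A" for t
    proof -
      have "(poly p t)\<^sup>2 \<le> m\<^sup>2"
        using power_mono[OF \<open>t \<in> rspec A \<Longrightarrow> \<bar>poly p t\<bar> \<le> m\<close>[OF that], of 2] by simp
      also have "\<dots> < (norm (op_poly p A))\<^sup>2" using gt \<open>0 \<le> m\<close> by (intro power_strict_mono) auto
      finally show ?thesis by (simp add: q_def power2_eq_square)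
    qed
    then have "bounded_below (op_poly q A)"
      using that(3) by (intro op_poly_bounded_below A) (auto simp: q_def)
    moreover have "norm (op_poly p A) > 0" using gt \<open>0 \<le> m\<close> by linarith
    ultimately show False
      using not_bounded_below_norm_sq[OF selfadj_op_poly[OF A], of p]
      by (simp add: q_def op_poly_diff op_poly_mult op_poly_const)
  qed
  show ?thesis
  proof (cases "rspec A = {}")
    case False
    then obtain t where t: "t \<in> rspec A" by blast
    show ?thesis
    proof (cases "[:(norm (op_poly p A))\<^sup>2:] = p * p")
      case True
      \<comment> \<open>Here \<open>p * p\<close> is constant, so its value at any spectral point is
        already the squared norm.\<close>
      then have "poly [:(norm (op_poly p A))\<^sup>2:] t = poly (p * p) t" by (rule arg_cong)
      then have "(norm (op_poly p A))\<^sup>2 = (poly p t)\<^sup>2" by (simp add: power2_eq_square)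
      also have "\<dots> \<le> m\<^sup>2" using power_mono[OF le[OF t], of 2] by simp
      finally show ?thesis using m by (rule power2_le_imp_le)
    qed (use key m le in blast)
  next
    case True
    \<comment> \<open>An empty spectrum forces the zero space: the bound with \<open>m = 0\<close>
      gives \<open>A = 0\<close>, while \<open>A\<close> is bounded below because \<open>0\<close>
      is not in the spectrum.\<close>
    have "norm (op_poly [:0, 1:] A) \<le> 0" by (rule key) (use True in auto)
    then have "A = 0" by (simp add: op_poly_id)
    moreover have "bounded_below (op_poly [:- 0, 1:] A)"
      by (rule bounded_below_if_not_in_rspec) (use True in auto)
    ultimately obtain c where "c > 0" "\<And>x::'a. c * norm x \<le> 0"
      by (auto simp: bounded_below_def op_poly_id)
    then have "x = 0" for x :: 'a by (simp add: mult_le_0_iff)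
    then have "op_poly p A = 0" by (metis blinfun_eqI)
    with m show ?thesis by simp
  qed
qed

section \<open>Continuous functional calculus of a positive operator\<close>

text \<open>Weierstrass approximation with errors \<open>1 / (n + 1)\<close>. Continuity on the
  whole half-line lets one hypothesis on \<open>f\<close> serve every \<open>K\<close>.\<close>

lemma ex_poly_uniform_limit:
  fixes f :: "real \<Rightarrow> real"
  assumes "continuous_on {0..} f"
  obtains p where "uniform_limit {0..K} (\<lambda>n. poly (p n)) f sequentially"
proof -
  have cont: "continuous_on {0..K} f" using assms by (rule continuous_on_subset) auto
  have "\<exists>p. \<forall>t\<in>{0..K}. \<bar>f t - poly p t\<bar> < e" if e: "e > 0" for e
  proof -
    obtain g where g: "real_polynomial_function g" "\<And>t. t \<in> {0..K} \<Longrightarrow> \<bar>f t - g t\<bar> < e"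
      using Stone_Weierstrass_real_polynomial_function[OF compact_Icc cont e] by blast
    then obtain a n where "g = (\<lambda>x. \<Sum>i\<le>n. a i * x ^ i)"
      by (auto simp: real_polynomial_function_iff_sum)
    then have "g = poly (\<Sum>i\<le>n. monom (a i) i)" by (simp add: poly_sum poly_monom fun_eq_iff)
    with g(2) show ?thesis by blast
  qed
  then have "\<exists>p. \<forall>t\<in>{0..K}. \<bar>f t - poly p t\<bar> < inverse (real (Suc n))" for n by simp
  then obtain p where p: "\<And>n t. t \<in> {0..K} \<Longrightarrow> \<bar>f t - poly (p n) t\<bar> < inverse (real (Suc n))"
    by metis
  have "uniform_limit {0..K} (\<lambda>n. poly (p n)) f sequentially"
  proof (rule uniform_limitI)
    fix e :: real assume "e > 0"
    then have "\<forall>\<^sub>F n in sequentially. inverse (real (Suc n)) < e"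
      using order_tendstoD(2)[OF LIMSEQ_inverse_real_of_nat] by blast
    then show "\<forall>\<^sub>F n in sequentially. \<forall>t\<in>{0..K}. dist (poly (p n) t) (f t) < e"
    proof eventually_elim
      case (elim n)
      then show ?case using p[of _ n] by (force simp: dist_real_def abs_minus_commute)
    qed
  qed
  then show thesis by (rule that)
qed

text \<open>Two sequences are compared so that \<open>p = q\<close> yields the Cauchy property and
  \<open>p \<noteq> q\<close> the independence of the limit from the choice of polynomials.\<close>

lemma op_poly_diff_small:
  fixes A :: "'a::chilbert_space \<Rightarrow>\<^sub>L 'a"
  assumes A: "selfadj A"
    and p: "uniform_limit (rspec A) (\<lambda>n. poly (p n)) f sequentially"
    and q: "uniform_limit (rspec A) (\<lambda>n. poly (q n)) f sequentially"
    and e: "e > 0"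
  shows "\<exists>N. \<forall>m\<ge>N. \<forall>n\<ge>N. norm (op_poly (p m) A - op_poly (q n) A) < e"
proof -
  obtain N1 where N1: "\<And>n t. n \<ge> N1 \<Longrightarrow> t \<in> rspec A \<Longrightarrow> dist (poly (p n) t) (f t) < e / 4"
    using uniform_limitD[OF p, of "e / 4"] e unfolding eventually_sequentially by auto
  obtain N2 where N2: "\<And>n t. n \<ge> N2 \<Longrightarrow> t \<in> rspec A \<Longrightarrow> dist (poly (q n) t) (f t) < e / 4"
    using uniform_limitD[OF q, of "e / 4"] e unfolding eventually_sequentially by auto
  have "norm (op_poly (p m) A - op_poly (q n) A) < e" if "m \<ge> max N1 N2" "n \<ge> max N1 N2" for m n
  proof -
    have "norm (op_poly (p m - q n) A) \<le> e / 2"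
    proof (rule norm_op_poly_le[OF A])
      fix t assume t: "t \<in> rspec A"
      have "dist (poly (p m) t) (f t) < e / 4" by (rule N1) (use that t in auto)
      moreover have "dist (poly (q n) t) (f t) < e / 4" by (rule N2) (use that t in auto)
      ultimately show "\<bar>poly (p m - q n) t\<bar> \<le> e / 2"
        unfolding dist_real_def poly_diff by linarith
    qed (use e in simp)
    with e show ?thesis by (simp add: op_poly_diff)
  qed
  then show ?thesis by blast
qed

text \<open>Justifies the definite description in \<open>op_cfc\<close>: the limit exists and is
  common to all approximating sequences, and the given \<open>p\<close> rules out that the defining
  condition holds vacuously.\<close>

lemma op_cfc_tendsto:
  fixes A :: "'a::chilbert_space \<Rightarrow>\<^sub>L 'a"
  assumes A: "pos_op A" and f: "continuous_on {0..} f"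
    and p: "uniform_limit (rspec A) (\<lambda>n. poly (p n)) f sequentially"
  shows "(\<lambda>n. op_poly (p n) A) \<longlonglongrightarrow> op_cfc f A"
proof -
  have sa: "selfadj A" using A by (simp add: pos_op_def)
  note diff = op_poly_diff_small[OF sa]
  have "Cauchy (\<lambda>n. op_poly (p n) A)"
    by (rule CauchyI) (use diff[OF p p] in blast)
  then obtain T where T: "(\<lambda>n. op_poly (p n) A) \<longlonglongrightarrow> T"
    using Cauchy_convergent convergent_def by blast
  have lim: "(\<lambda>n. op_poly (q n) A) \<longlonglongrightarrow> T"
    if q: "uniform_limit (rspec A) (\<lambda>n. poly (q n)) f sequentially" for q
  proof -
    have "(\<lambda>n. op_poly (q n) A - op_poly (p n) A) \<longlonglongrightarrow> 0"
    proof (rule LIMSEQ_I)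
      fix e :: real assume "e > 0"
      from diff[OF q p this] show "\<exists>N. \<forall>n\<ge>N. norm (op_poly (q n) A - op_poly (p n) A - 0) < e"
        by auto
    qed
    from tendsto_add[OF this T] show ?thesis by simp
  qed
  have "op_cfc f A = T"
    unfolding op_cfc_def
  proof (rule the_equality)
    fix T' assume "\<forall>p. uniform_limit (rspec A) (\<lambda>n. poly (p n)) f sequentially \<longrightarrow>
      (\<lambda>n. op_poly (p n) A) \<longlonglongrightarrow> T'"
    with p have "(\<lambda>n. op_poly (p n) A) \<longlonglongrightarrow> T'" by blast
    with T show "T' = T" by (metis LIMSEQ_unique)
  qed (use lim in blast)
  with T show ?thesis by simp
qed

text \<open>Allowing \<open>K\<close> to exceed \<open>norm A\<close> lets one sequence of
  polynomials serve two operators.\<close>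

lemma op_cfc_tendsto_Icc:
  fixes A :: "'a::chilbert_space \<Rightarrow>\<^sub>L 'a"
  assumes "pos_op A" "continuous_on {0..} f" "norm A \<le> K"
    and "uniform_limit {0..K} (\<lambda>n. poly (p n)) f sequentially"
  shows "(\<lambda>n. op_poly (p n) A) \<longlonglongrightarrow> op_cfc f A"
proof (rule op_cfc_tendsto[OF assms(1,2)])
  have "rspec A \<subseteq> {0..K}" using rspec_pos_op[OF assms(1)] assms(3) by force
  with assms(4) show "uniform_limit (rspec A) (\<lambda>n. poly (p n)) f sequentially"
    by (rule uniform_limit_on_subset)
qed

section \<open>Algebraic rules and norm bound of the calculus\<close>

lemma op_cfc_poly:
  assumes "pos_op A"
  shows "op_cfc (poly p) A = op_poly p A"
proof -
  have "(\<lambda>n. op_poly p A) \<longlonglongrightarrow> op_cfc (poly p) A"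
    by (rule op_cfc_tendsto[OF assms]) (auto intro!: continuous_intros uniform_limitI)
  then show ?thesis by (metis LIMSEQ_unique tendsto_const)
qed

lemma op_cfc_cong:
  fixes A :: "'a::chilbert_space \<Rightarrow>\<^sub>L 'a"
  assumes A: "pos_op A" and f: "continuous_on {0..} f" and eq: "\<And>t. t \<ge> 0 \<Longrightarrow> f t = g t"
  shows "op_cfc f A = op_cfc g A"
proof -
  have g: "continuous_on {0..} g" using f by (rule continuous_on_eq) (use eq in auto)
  obtain p where p: "uniform_limit {0..norm A} (\<lambda>n. poly (p n)) f sequentially"
    using ex_poly_uniform_limit[OF f] .
  then have "uniform_limit {0..norm A} (\<lambda>n. poly (p n)) g sequentially"
    by (rule uniform_limit_cong'[THEN iffD1, rotated 2]) (use eq in auto)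
  then show ?thesis
    using op_cfc_tendsto_Icc[OF A f _ p] op_cfc_tendsto_Icc[OF A g] by (metis LIMSEQ_unique order_refl)
qed

lemma op_cfc_add:
  fixes A :: "'a::chilbert_space \<Rightarrow>\<^sub>L 'a"
  assumes A: "pos_op A" and f: "continuous_on {0..} f" and g: "continuous_on {0..} g"
  shows "op_cfc (\<lambda>t. f t + g t) A = op_cfc f A + op_cfc g A"
proof -
  obtain p where p: "uniform_limit {0..norm A} (\<lambda>n. poly (p n)) f sequentially"
    using ex_poly_uniform_limit[OF f] .
  obtain q where q: "uniform_limit {0..norm A} (\<lambda>n. poly (q n)) g sequentially"
    using ex_poly_uniform_limit[OF g] .
  have "uniform_limit {0..norm A} (\<lambda>n. poly (p n + q n)) (\<lambda>t. f t + g t) sequentially"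
    using uniform_limit_add[OF p q] unfolding poly_add .
  then have "(\<lambda>n. op_poly (p n + q n) A) \<longlonglongrightarrow> op_cfc (\<lambda>t. f t + g t) A"
    by (intro op_cfc_tendsto_Icc[OF A]) (auto intro!: continuous_intros f g)
  moreover have "(\<lambda>n. op_poly (p n + q n) A) \<longlonglongrightarrow> op_cfc f A + op_cfc g A"
    unfolding op_poly_add
    by (intro tendsto_add op_cfc_tendsto_Icc[OF A f order_refl p]
        op_cfc_tendsto_Icc[OF A g order_refl q])
  ultimately show ?thesis by (rule LIMSEQ_unique)
qed

lemma op_cfc_mult:
  fixes A :: "'a::chilbert_space \<Rightarrow>\<^sub>L 'a"
  assumes A: "pos_op A" and f: "continuous_on {0..} f" and g: "continuous_on {0..} g"
  shows "op_cfc (\<lambda>t. f t * g t) A = op_cfc f A o\<^sub>L op_cfc g A"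
proof -
  obtain p where p: "uniform_limit {0..norm A} (\<lambda>n. poly (p n)) f sequentially"
    using ex_poly_uniform_limit[OF f] .
  obtain q where q: "uniform_limit {0..norm A} (\<lambda>n. poly (q n)) g sequentially"
    using ex_poly_uniform_limit[OF g] .
  have bdd: "bounded (h ` {0..norm A})" if "continuous_on {0..} h" for h :: "real \<Rightarrow> real"
    by (intro compact_imp_bounded compact_continuous_image continuous_on_subset[OF that]) auto
  have "uniform_limit {0..norm A} (\<lambda>n. poly (p n * q n)) (\<lambda>t. f t * g t) sequentially"
    using uniform_lim_mult[OF p q bdd[OF f] bdd[OF g]] unfolding poly_mult .
  then have "(\<lambda>n. op_poly (p n * q n) A) \<longlonglongrightarrow> op_cfc (\<lambda>t. f t * g t) A"
    by (intro op_cfc_tendsto_Icc[OF A]) (auto intro!: continuous_intros f g)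
  moreover have "(\<lambda>n. op_poly (p n * q n) A) \<longlonglongrightarrow> (op_cfc f A o\<^sub>L op_cfc g A)"
    unfolding op_poly_mult
    by (intro bounded_bilinear.tendsto[OF bounded_bilinear_blinfun_compose]
        op_cfc_tendsto_Icc[OF A f order_refl p] op_cfc_tendsto_Icc[OF A g order_refl q])
  ultimately show ?thesis by (rule LIMSEQ_unique)
qed

lemma op_cfc_const:
  assumes "pos_op A"
  shows "op_cfc (\<lambda>t. c) A = c *\<^sub>R id_blinfun"
proof -
  have "poly [:c:] = (\<lambda>t. c)" by auto
  then show ?thesis using op_cfc_poly[OF assms, of "[:c:]"] by (simp only: op_poly_const)
qed

lemma op_cfc_id:
  assumes "pos_op A"
  shows "op_cfc (\<lambda>t. t) A = A"
proof -
  have "poly [:0, 1:] = (\<lambda>t::real. t)" by auto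
  then show ?thesis using op_cfc_poly[OF assms, of "[:0, 1:]"] by (simp only: op_poly_id)
qed

lemma op_cfc_cmult:
  assumes "pos_op A" "continuous_on {0..} f"
  shows "op_cfc (\<lambda>t. c * f t) A = c *\<^sub>R op_cfc f A"
  using op_cfc_mult[OF assms(1) continuous_on_const assms(2), of c]
  by (simp add: op_cfc_const[OF assms(1)]) (rule blinfun_eqI, simp add: blinfun.scaleR_left)

lemma norm_op_cfc_le:
  fixes A :: "'a::chilbert_space \<Rightarrow>\<^sub>L 'a"
  assumes A: "pos_op A" and f: "continuous_on {0..} f"
    and m: "0 \<le> m" and le: "\<And>t. t \<in> {0..norm A} \<Longrightarrow> \<bar>f t\<bar> \<le> m"
  shows "norm (op_cfc f A) \<le> m"
proof (rule field_le_epsilon)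
  fix e :: real assume e: "e > 0"
  obtain p where p: "uniform_limit {0..norm A} (\<lambda>n. poly (p n)) f sequentially"
    using ex_poly_uniform_limit[OF f] .
  have "\<forall>\<^sub>F n in sequentially. norm (op_poly (p n) A) \<le> m + e"
    using uniform_limitD[OF p e]
  proof eventually_elim
    case (elim n)
    have "\<bar>poly (p n) t\<bar> \<le> m + e" if "t \<in> {0..norm A}" for t
      using elim[rule_format, OF that] le[OF that] by (simp add: dist_real_def)
    then show ?case
      using A m e rspec_pos_op[OF A] by (intro norm_op_poly_le) (auto simp: pos_op_def)
  qed
  then show "norm (op_cfc f A) \<le> m + e"
    using tendsto_norm[OF op_cfc_tendsto_Icc[OF A f order_refl p]]
    by (intro tendsto_upperbound[of _ _ sequentially]) auto
qed

section \<open>Self-adjointness, intertwining, positivity and composition\<close>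

lemma selfadj_op_cfc:
  fixes A :: "'a::chilbert_space \<Rightarrow>\<^sub>L 'a"
  assumes A: "pos_op A" and f: "continuous_on {0..} f"
  shows "selfadj (op_cfc f A)"
  unfolding selfadj_def
proof (intro allI)
  fix x y
  obtain p where p: "uniform_limit {0..norm A} (\<lambda>n. poly (p n)) f sequentially"
    using ex_poly_uniform_limit[OF f] .
  note lim = blinfun.tendsto[OF op_cfc_tendsto_Icc[OF A f order_refl p] tendsto_const]
  have "(\<lambda>n. cinner (op_poly (p n) A x) y) \<longlonglongrightarrow> cinner (op_cfc f A x) y"
    by (intro bounded_bilinear.tendsto[OF bounded_bilinear_cinner] lim tendsto_const)
  moreover have "cinner (op_poly (p n) A x) y = cinner x (op_poly (p n) A y)" for n
    using A by (intro selfadjD selfadj_op_poly) (simp add: pos_op_def)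
  moreover have "(\<lambda>n. cinner x (op_poly (p n) A y)) \<longlonglongrightarrow> cinner x (op_cfc f A y)"
    by (intro bounded_bilinear.tendsto[OF bounded_bilinear_cinner] lim tendsto_const)
  ultimately show "cinner (op_cfc f A x) y = cinner x (op_cfc f A y)"
    by (metis (no_types, lifting) LIMSEQ_unique ext)
qed

text \<open>The rule for polynomials passes to the limit, with the same polynomials for both
  operators; hence the interval reaching up to the larger norm.\<close>

lemma op_cfc_intertwine:
  fixes A B :: "'a::chilbert_space \<Rightarrow>\<^sub>L 'a"
  assumes A: "pos_op A" and B: "pos_op B" and f: "continuous_on {0..} f"
    and S: "S o\<^sub>L A = B o\<^sub>L S"
  shows "S o\<^sub>L op_cfc f A = op_cfc f B o\<^sub>L S"
proof -
  obtain p where p: "uniform_limit {0..max (norm A) (norm B)} (\<lambda>n. poly (p n)) f sequentially"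
    using ex_poly_uniform_limit[OF f] .
  have "(\<lambda>n. S o\<^sub>L op_poly (p n) A) \<longlonglongrightarrow> (S o\<^sub>L op_cfc f A)"
    by (intro bounded_bilinear.tendsto[OF bounded_bilinear_blinfun_compose] tendsto_const
        op_cfc_tendsto_Icc[OF A f _ p]) auto
  moreover have "(\<lambda>n. op_poly (p n) B o\<^sub>L S) \<longlonglongrightarrow> (op_cfc f B o\<^sub>L S)"
    by (intro bounded_bilinear.tendsto[OF bounded_bilinear_blinfun_compose] tendsto_const
        op_cfc_tendsto_Icc[OF B f _ p]) auto
  ultimately show ?thesis
    unfolding op_poly_intertwine[OF S] by (rule LIMSEQ_unique)
qed

text \<open>By multiplicativity \<open>op_cfc f A\<close> is the square of the self-adjoint operator
  belonging to \<open>sqrt (f t)\<close>.\<close>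

lemma pos_op_cfc:
  fixes A :: "'a::chilbert_space \<Rightarrow>\<^sub>L 'a"
  assumes A: "pos_op A" and f: "continuous_on {0..} f" and pos: "\<And>t. t \<ge> 0 \<Longrightarrow> f t \<ge> 0"
  shows "pos_op (op_cfc f A)"
proof -
  define g where "g = (\<lambda>t. sqrt (f t))"
  have g: "continuous_on {0..} g" unfolding g_def by (intro continuous_intros f)
  have "op_cfc f A = op_cfc (\<lambda>t. g t * g t) A"
    using pos by (intro op_cfc_cong[OF A f]) (simp add: g_def)
  also have "\<dots> = op_cfc g A o\<^sub>L op_cfc g A" by (rule op_cfc_mult[OF A g g])
  finally have "Re (cinner (op_cfc f A x) x) = (norm (op_cfc g A x))\<^sup>2" for x
    by (simp add: selfadjD[OF selfadj_op_cfc[OF A g]] flip: Re_cinner_self)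
  then show ?thesis by (simp add: pos_op_def selfadj_op_cfc[OF A f])
qed

lemma op_cfc_mono:
  fixes A :: "'a::chilbert_space \<Rightarrow>\<^sub>L 'a"
  assumes A: "pos_op A" and f: "continuous_on {0..} f" and g: "continuous_on {0..} g"
    and le: "\<And>t. t \<ge> 0 \<Longrightarrow> f t \<le> g t"
  shows "Re (cinner (op_cfc f A x) x) \<le> Re (cinner (op_cfc g A x) x)"
proof -
  have d: "continuous_on {0..} (\<lambda>t. g t - f t)" by (intro continuous_intros f g)
  have "op_cfc g A = op_cfc f A + op_cfc (\<lambda>t. g t - f t) A"
    using op_cfc_add[OF A f d] by simp
  moreover have "0 \<le> Re (cinner (op_cfc (\<lambda>t. g t - f t) A x) x)"
    using pos_op_cfc[OF A d] le by (simp add: pos_op_def)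
  ultimately show ?thesis by (simp add: blinfun.add_left cinner_add_left)
qed

text \<open>Proved for polynomial \<open>g\<close> by induction, then extended by uniform
  approximation and the norm bound of the calculus.\<close>

lemma op_cfc_compose:
  fixes A :: "'a::chilbert_space \<Rightarrow>\<^sub>L 'a"
  assumes A: "pos_op A" and f: "continuous_on {0..} f" and pos: "\<And>t. t \<ge> 0 \<Longrightarrow> f t \<ge> 0"
    and g: "continuous_on {0..} g"
  shows "op_cfc g (op_cfc f A) = op_cfc (\<lambda>t. g (f t)) A"
proof -
  let ?B = "op_cfc f A"
  have B: "pos_op ?B" by (rule pos_op_cfc[OF A f pos])
  have polyf: "continuous_on {0..} (\<lambda>t. poly p (f t))" for p by (intro continuous_intros f)
  have gf: "continuous_on {0..} (\<lambda>t. g (f t))"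
    by (rule continuous_on_compose2[OF g f]) (use pos in auto)
  have poly: "op_poly p ?B = op_cfc (\<lambda>t. poly p (f t)) A" for p
  proof (induction p)
    case 0
    then show ?case using op_cfc_const[OF A, of 0] by simp
  next
    case (pCons a p)
    have "op_cfc (\<lambda>t. poly (pCons a p) (f t)) A = op_cfc (\<lambda>t. a + f t * poly p (f t)) A" by simp
    also have "\<dots> = a *\<^sub>R id_blinfun + (?B o\<^sub>L op_cfc (\<lambda>t. poly p (f t)) A)"
      by (subst op_cfc_add[OF A], (intro continuous_intros f)+)
        (simp add: op_cfc_const[OF A] op_cfc_mult[OF A f polyf])
    finally show ?case by (simp add: op_poly_pCons pCons)
  qed
  have "bounded (f ` {0..norm A})"
    by (intro compact_imp_bounded compact_continuous_image continuous_on_subset[OF f]) auto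
  then obtain L where L: "\<And>t. t \<in> {0..norm A} \<Longrightarrow> \<bar>f t\<bar> \<le> L"
    unfolding bounded_iff real_norm_def by blast
  \<comment> \<open>The interval must contain both the values of \<open>f\<close> on
    \<open>{0..norm A}\<close> and the spectrum of \<open>op_cfc f A\<close>.\<close>
  define K where "K = max L (norm ?B)"
  obtain p where p: "uniform_limit {0..K} (\<lambda>n. poly (p n)) g sequentially"
    using ex_poly_uniform_limit[OF g] .
  have "(\<lambda>n. op_poly (p n) ?B) \<longlonglongrightarrow> op_cfc g ?B"
    by (rule op_cfc_tendsto_Icc[OF B g _ p]) (simp add: K_def)
  moreover have "(\<lambda>n. op_poly (p n) ?B) \<longlonglongrightarrow> op_cfc (\<lambda>t. g (f t)) A"
  proof (rule LIM_zero_cancel, rule LIMSEQ_I)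
    fix e :: real assume "e > 0"
    then have "\<forall>\<^sub>F n in sequentially. \<forall>s\<in>{0..K}. dist (poly (p n) s) (g s) < e / 2"
      by (intro uniform_limitD[OF p]) simp
    then obtain N where N: "\<And>n s. n \<ge> N \<Longrightarrow> s \<in> {0..K} \<Longrightarrow> dist (poly (p n) s) (g s) < e / 2"
      unfolding eventually_sequentially by blast
    have "norm (op_poly (p n) ?B - op_cfc (\<lambda>t. g (f t)) A) < e" if "n \<ge> N" for n
    proof -
      let ?d = "\<lambda>t. poly (p n) (f t) - g (f t)"
      have d: "continuous_on {0..} ?d" by (intro continuous_on_diff polyf gf)
      have "norm (op_cfc ?d A) \<le> e / 2"
      proof (rule norm_op_cfc_le[OF A d])
        fix t assume t: "t \<in> {0..norm A}"
        then have "f t \<in> {0..K}" using L[OF t] pos[of t] by (auto simp: K_def)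
        then show "\<bar>?d t\<bar> \<le> e / 2"
          using N[OF that, of "f t"] by (simp add: dist_real_def)
      qed (use \<open>e > 0\<close> in simp)
      moreover have "op_poly (p n) ?B = op_cfc (\<lambda>t. g (f t)) A + op_cfc ?d A"
        using op_cfc_add[OF A gf d] by (simp add: poly)
      ultimately show ?thesis using \<open>e > 0\<close> by simp
    qed
    then show "\<exists>N. \<forall>n\<ge>N. norm (op_poly (p n) ?B - op_cfc (\<lambda>t. g (f t)) A - 0) < e"
      by auto
  qed
  ultimately show ?thesis by (rule LIMSEQ_unique)
qed

section \<open>Powers of positive operators\<close>

definition rpow :: "real \<Rightarrow> real \<Rightarrow> real" where
  "rpow a t = (if a = 0 then 1 else t powr a)"

lemma op_powr_eq_cfc: "op_powr A a = op_cfc (rpow a) A"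
  by (simp add: op_powr_def rpow_def[abs_def])

lemma continuous_on_rpow: "a \<ge> 0 \<Longrightarrow> continuous_on {0..} (rpow a)"
  unfolding rpow_def[abs_def] by (cases "a = 0") (auto intro!: continuous_intros continuous_on_powr')

lemma rpow_nonneg: "0 \<le> rpow a t"
  by (simp add: rpow_def)

lemma rpow_rpow: "rpow b (rpow a t) = rpow (a * b) t"
  by (simp add: rpow_def powr_powr)

text \<open>The exponent 0 is excluded because \<open>0 powr 0 = 0\<close>, whereas
  \<open>rpow 0 t = 1\<close>.\<close>

lemma rpow_powr: "b \<noteq> 0 \<Longrightarrow> rpow a t powr b = rpow (a * b) t"
  by (simp add: rpow_def powr_powr)

lemma pos_op_powr:
  fixes A :: "'a::chilbert_space \<Rightarrow>\<^sub>L 'a"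
  assumes "pos_op A" "a \<ge> 0"
  shows "pos_op (op_powr A a)"
  unfolding op_powr_eq_cfc
  by (rule pos_op_cfc[OF assms(1) continuous_on_rpow[OF assms(2)] rpow_nonneg])

lemma op_powr_powr:
  fixes A :: "'a::chilbert_space \<Rightarrow>\<^sub>L 'a"
  assumes "pos_op A" "a \<ge> 0" "b \<ge> 0"
  shows "op_powr (op_powr A a) b = op_powr A (a * b)"
  unfolding op_powr_eq_cfc
  using op_cfc_compose[OF assms(1) continuous_on_rpow[OF assms(2)] rpow_nonneg
      continuous_on_rpow[OF assms(3)]]
  by (simp add: rpow_rpow)

text \<open>Doubling the exponent cancels the square root in the modulus, so the inequalities can be
  proved for powers of \<open>adj S o\<^sub>L S\<close>.\<close>

lemma op_powr_abs:
  fixes S :: "'a::chilbert_space \<Rightarrow>\<^sub>L 'a"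
  assumes "clinear_op S" "b \<ge> 0"
  shows "op_powr (op_abs S) (2 * b) = op_powr (adj S o\<^sub>L S) b"
  unfolding op_abs_def
  using op_powr_powr[OF pos_op_adj_compose[OF assms(1)], of "1/2" "2 * b"] assms(2) by simp

text \<open>The convex function \<open>u powr r\<close> lies above its tangent at \<open>s\<close>.
  This is Young's inequality with weights \<open>1 / r\<close> and \<open>1 - 1 / r\<close>,
  multiplied by \<open>r\<close>.\<close>

lemma powr_tangent:
  fixes r s u :: real
  assumes "r \<ge> 1" "s \<ge> 0" "u \<ge> 0"
  shows "r * s powr (r - 1) * u \<le> u powr r + (r - 1) * s powr r"
proof (cases "u = 0 \<or> s = 0")
  case False
  with assms have us: "u > 0" "s > 0" by auto
  have "(u powr r) powr (1 / r) * (s powr r) powr (1 - 1 / r)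
      \<le> 1 / r * u powr r + (1 - 1 / r) * s powr r"
    using assms us by (intro Youngs_inequality_0) auto
  moreover have "(u powr r) powr (1 / r) = u"
    using assms us by (simp add: powr_powr)
  moreover have "(s powr r) powr (1 - 1 / r) = s powr (r - 1)"
    using assms by (simp add: powr_powr algebra_simps)
  ultimately have "u * s powr (r - 1) \<le> 1 / r * u powr r + (1 - 1 / r) * s powr r"
    by simp
  then have "r * (u * s powr (r - 1)) \<le> r * (1 / r * u powr r + (1 - 1 / r) * s powr r)"
    using assms by (intro mult_left_mono) auto
  then show ?thesis using assms by (simp add: algebra_simps)
qed (use assms in auto)

text \<open>Apply the tangent inequality at \<open>s = Re (cinner (op_powr A a x) x)\<close> to the spectrum.\<close>

lemma McCarthy_inequality:
  fixes A :: "'a::chilbert_space \<Rightarrow>\<^sub>L 'a"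
  assumes A: "pos_op A" and a: "a \<ge> 0" and r: "r \<ge> 1" and x: "norm x = 1"
  shows "Re (cinner (op_powr A a x) x) powr r \<le> Re (cinner (op_powr A (a * r) x) x)"
proof -
  define s where "s = Re (cinner (op_powr A a x) x)"
  have s: "s \<ge> 0" using pos_op_powr[OF A a] by (simp add: s_def pos_op_def)
  have ca: "continuous_on {0..} (rpow a)" and car: "continuous_on {0..} (rpow (a * r))"
    using a r by (auto intro: continuous_on_rpow)
  have "Re (cinner (op_cfc (\<lambda>t. (r * s powr (r - 1)) * rpow a t) A x) x)
      \<le> Re (cinner (op_cfc (\<lambda>t. rpow (a * r) t + (r - 1) * s powr r) A x) x)"
  proof (rule op_cfc_mono[OF A])
    fix t :: real
    show "r * s powr (r - 1) * rpow a t \<le> rpow (a * r) t + (r - 1) * s powr r"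
      using powr_tangent[OF r s rpow_nonneg[of a t]] r by (simp add: rpow_powr)
  qed (intro continuous_intros ca car)+
  \<comment> \<open>Evaluation at the unit vector \<open>x\<close> turns \<open>rpow a\<close> into
    \<open>s\<close> and leaves constants unchanged.\<close>
  then have "r * s powr (r - 1) * s \<le> Re (cinner (op_powr A (a * r) x) x) + (r - 1) * s powr r"
    by (simp add: op_cfc_cmult[OF A ca] op_cfc_add[OF A car] op_cfc_const[OF A] op_powr_eq_cfc s_def
        blinfun.add_left blinfun.scaleR_left cinner_add_left cinner_scaleR_left Re_cinner_self x)
  moreover have "s powr (r - 1) * s = s powr r"
    using s powr_mult_base[of s "r - 1"] by (simp add: mult.commute)
  ultimately show ?thesis by (simp add: s_def algebra_simps)
qed

section \<open>The mixed Schwarz inequality\<close>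

lemma Re_cinner_op_cfc_square:
  fixes A :: "'a::chilbert_space \<Rightarrow>\<^sub>L 'a"
  assumes A: "pos_op A" and f: "continuous_on {0..} f"
  shows "Re (cinner (op_cfc (\<lambda>t. f t * f t) A x) x) = (norm (op_cfc f A x))\<^sup>2"
  by (simp add: op_cfc_mult[OF A f f] selfadjD[OF selfadj_op_cfc[OF A f]] flip: Re_cinner_self)

text \<open>The fractions \<open>s / (s + t)\<close> and \<open>t / (s + t)\<close> add up to 1, and
  each is at most its own power with exponent \<open>a \<le> 1\<close>.\<close>

lemma powr_add_le:
  fixes a s t :: real
  assumes "0 \<le> s" "0 \<le> t" "0 \<le> a" "a \<le> 1"
  shows "(s + t) powr a \<le> s powr a + t powr a"
proof (cases "s + t = 0")
  case False
  with assms have pos: "s + t > 0" by simp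
  have le: "(u / (s + t)) * (s + t) powr a \<le> u powr a" if "0 \<le> u" "u \<le> s + t" for u
  proof -
    have "u / (s + t) \<le> (u / (s + t)) powr a"
    proof (cases "u = 0")
      case False
      then show ?thesis
        using powr_mono'[of a 1 "u / (s + t)"] assms that pos by simp
    qed simp
    then have "u / (s + t) * (s + t) powr a \<le> (u / (s + t)) powr a * (s + t) powr a"
      by (rule mult_right_mono) simp
    also have "\<dots> = u powr a" using pos by (simp add: powr_divide)
    finally show ?thesis .
  qed
  have "(s + t) powr a = s / (s + t) * (s + t) powr a + t / (s + t) * (s + t) powr a"
    using pos by (simp flip: distrib_right add_divide_distrib)
  with le[of s] le[of t] assms show ?thesis by simp
qed (use assms in auto)

text \<open>Controls the shift uniformly in \<open>t\<close>, so that it can be removed from the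
  mixed Schwarz inequality. The witness satisfies
  \<open>\<epsilon> powr \<alpha> = \<delta>\<close>; for \<open>\<alpha> = 0\<close> any positive
  shift works.\<close>

lemma ex_powr_shift_le:
  assumes "0 \<le> \<alpha>" "\<alpha> \<le> 1" "\<delta> > 0"
  obtains \<epsilon> where "\<epsilon> > 0" "\<And>t. t \<ge> 0 \<Longrightarrow> (t + \<epsilon>) powr \<alpha> \<le> rpow \<alpha> t + \<delta>"
proof (cases "\<alpha> = 0")
  case True
  then show thesis using assms by (intro that[of 1]) (auto simp: rpow_def)
next
  case False
  show thesis
  proof (rule that[of "\<delta> powr (1 / \<alpha>)"])
    fix t :: real assume "t \<ge> 0"
    then show "(t + \<delta> powr (1 / \<alpha>)) powr \<alpha> \<le> rpow \<alpha> t + \<delta>"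
      using powr_add_le[of t "\<delta> powr (1 / \<alpha>)" \<alpha>] False assms by (simp add: rpow_def powr_powr)
  qed (use assms in simp)
qed

text \<open>Formally \<open>S = g(Q)\<^sup>-\<^sup>1 S g(P)\<close> with \<open>g(t) = t powr (\<alpha> / 2)\<close>. Replacing \<open>t\<close> by \<open>t + \<epsilon>\<close> makes
  \<open>g(Q)\<close> invertible, so that no polar decomposition is needed.\<close>

lemma mixed_Schwarz_shifted:
  fixes S :: "'a::chilbert_space \<Rightarrow>\<^sub>L 'a"
  assumes S: "clinear_op S" and \<alpha>: "0 \<le> \<alpha>" "\<alpha> \<le> 1" and \<epsilon>: "\<epsilon> > 0"
  defines "P \<equiv> adj S o\<^sub>L S" and "Q \<equiv> S o\<^sub>L adj S"
  shows "(cmod (cinner (S x) y))\<^sup>2 \<le>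
    Re (cinner (op_cfc (\<lambda>t. (t + \<epsilon>) powr \<alpha>) P x) x) * Re (cinner (op_powr Q (1 - \<alpha>) y) y)"
proof -
  have P: "pos_op P" unfolding P_def by (rule pos_op_adj_compose[OF S])
  have Q: "pos_op Q"
    unfolding Q_def using pos_op_adj_compose[OF clinear_op_adj[OF S]] by (simp add: adj_adj[OF S])
  \<comment> \<open>On the half-line \<open>h\<close> is the reciprocal of \<open>g\<close>, so
    \<open>op_cfc h P\<close> undoes \<open>op_cfc g P\<close>.\<close>
  define g h where "g = (\<lambda>t. (t + \<epsilon>) powr (\<alpha> / 2))" and "h = (\<lambda>t. (t + \<epsilon>) powr (- \<alpha> / 2))"
  have g: "continuous_on {0..} g" and h: "continuous_on {0..} h"
    unfolding g_def h_def using \<epsilon> by (auto intro!: continuous_intros)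
  have gg: "continuous_on {0..} (\<lambda>t. g t * g t)" and hg: "continuous_on {0..} (\<lambda>t. h t * g t)"
    and th: "continuous_on {0..} (\<lambda>t. t * h t)" and hth: "continuous_on {0..} (\<lambda>t. h t * (t * h t))"
    by (intro continuous_intros g h)+
  have "op_cfc h P o\<^sub>L op_cfc g P = op_cfc (\<lambda>t. h t * g t) P"
    by (rule op_cfc_mult[OF P h g, symmetric])
  also have "\<dots> = op_cfc (\<lambda>t. 1) P"
    by (rule op_cfc_cong[OF P hg]) (use \<epsilon> in \<open>simp add: g_def h_def flip: powr_add\<close>)
  also have "\<dots> = id_blinfun" by (simp add: op_cfc_const[OF P])
  finally have "x = op_cfc h P (op_cfc g P x)"
    by (metis blinfun_apply_blinfun_compose blinfun_apply_id_blinfun id_apply)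
  \<comment> \<open>\<open>S\<close> intertwines \<open>P\<close> and \<open>Q\<close>, since
    \<open>S P\<close> and \<open>Q S\<close> are both
    \<open>S o\<^sub>L adj S o\<^sub>L S\<close>.\<close>
  moreover have "S (op_cfc h P z) = op_cfc h Q (S z)" for z
    using arg_cong[OF op_cfc_intertwine[OF P Q h, of S], of "\<lambda>T. T z"]
    by (simp add: P_def Q_def blinfun_compose_assoc')
  ultimately have "cinner (S x) y = cinner (op_cfc h Q (S (op_cfc g P x))) y" by metis
  also have "\<dots> = cinner (op_cfc g P x) (adj S (op_cfc h Q y))"
    by (simp add: selfadjD[OF selfadj_op_cfc[OF Q h]] cinner_adj[OF S])
  finally have "cinner (S x) y = cinner (op_cfc g P x) (adj S (op_cfc h Q y))" .
  then have "(cmod (cinner (S x) y))\<^sup>2 \<le> (norm (op_cfc g P x))\<^sup>2 * (norm (adj S (op_cfc h Q y)))\<^sup>2"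
    using power_mono[OF cmod_cinner_le, of "op_cfc g P x" "adj S (op_cfc h Q y)" 2]
    by (simp add: power_mult_distrib)
  moreover have "(norm (op_cfc g P x))\<^sup>2 = Re (cinner (op_cfc (\<lambda>t. (t + \<epsilon>) powr \<alpha>) P x) x)"
  proof -
    have "op_cfc (\<lambda>t. g t * g t) P = op_cfc (\<lambda>t. (t + \<epsilon>) powr \<alpha>) P"
      by (rule op_cfc_cong[OF P gg]) (simp add: g_def flip: powr_add)
    then show ?thesis by (simp flip: Re_cinner_op_cfc_square[OF P g])
  qed
  moreover have H: "(norm (adj S (op_cfc h Q y)))\<^sup>2 \<le> Re (cinner (op_powr Q (1 - \<alpha>) y) y)"
  proof -
    have "cinner (op_cfc h Q (Q z)) y = cinner (Q z) (op_cfc h Q y)" for z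
      by (rule selfadjD[OF selfadj_op_cfc[OF Q h]])
    moreover have "cinner (Q z) z = cinner (adj S z) (adj S z)" for z
      by (simp add: Q_def cinner_adj[OF S])
    ultimately have "(norm (adj S (op_cfc h Q y)))\<^sup>2 = Re (cinner (op_cfc h Q (Q (op_cfc h Q y))) y)"
      by (simp only: Re_cinner_self)
    also have "\<dots> = Re (cinner (op_cfc (\<lambda>t. h t * (t * h t)) Q y) y)"
      by (simp add: op_cfc_mult[OF Q h th] op_cfc_mult[OF Q continuous_on_id h] op_cfc_id[OF Q])
    also have "\<dots> \<le> Re (cinner (op_powr Q (1 - \<alpha>) y) y)"
      unfolding op_powr_eq_cfc
    proof (rule op_cfc_mono[OF Q hth])
      show "continuous_on {0..} (rpow (1 - \<alpha>))" using \<alpha> by (intro continuous_on_rpow) simp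
      fix t :: real assume t: "t \<ge> 0"
      \<comment> \<open>The exponent \<open>- \<alpha>\<close> is not positive, so dropping the
        shift only increases the power; at \<open>t = 0\<close> the factor \<open>t\<close>
        vanishes.\<close>
      have "h t * (t * h t) = t * (t + \<epsilon>) powr (- \<alpha>)" by (simp add: h_def flip: powr_add)
      also have "\<dots> \<le> rpow (1 - \<alpha>) t"
      proof (cases "t = 0")
        case False
        then have "t * (t + \<epsilon>) powr (- \<alpha>) \<le> t * t powr (- \<alpha>)"
          using t \<alpha> \<epsilon> by (intro mult_left_mono powr_mono2') auto
        also have "\<dots> = rpow (1 - \<alpha>) t"
          using t False powr_mult_base[of t "- \<alpha>"] by (simp add: rpow_def)
        finally show ?thesis .
      qed (simp add: rpow_nonneg)
      finally show "h t * (t * h t) \<le> rpow (1 - \<alpha>) t" .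
    qed
    finally show ?thesis .
  qed
  moreover from H have "(norm (op_cfc g P x))\<^sup>2 * (norm (adj S (op_cfc h Q y)))\<^sup>2
      \<le> (norm (op_cfc g P x))\<^sup>2 * Re (cinner (op_powr Q (1 - \<alpha>) y) y)"
    by (rule mult_left_mono) simp
  ultimately show ?thesis by simp
qed

lemma mixed_Schwarz:
  fixes S :: "'a::chilbert_space \<Rightarrow>\<^sub>L 'a"
  assumes S: "clinear_op S" and \<alpha>: "0 \<le> \<alpha>" "\<alpha> \<le> 1"
  shows "(cmod (cinner (S x) y))\<^sup>2 \<le>
    Re (cinner (op_powr (adj S o\<^sub>L S) \<alpha> x) x) * Re (cinner (op_powr (S o\<^sub>L adj S) (1 - \<alpha>) y) y)"
proof (rule field_le_epsilon)
  fix e :: real assume e: "e > 0"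
  let ?P = "adj S o\<^sub>L S"
  define X Y where "X = Re (cinner (op_powr ?P \<alpha> x) x)"
    and "Y = Re (cinner (op_powr (S o\<^sub>L adj S) (1 - \<alpha>) y) y)"
  have P: "pos_op ?P" by (rule pos_op_adj_compose[OF S])
  have "pos_op (S o\<^sub>L adj S)"
    using pos_op_adj_compose[OF clinear_op_adj[OF S]] by (simp add: adj_adj[OF S])
  then have "pos_op (op_powr (S o\<^sub>L adj S) (1 - \<alpha>))" by (rule pos_op_powr) (use \<alpha> in simp)
  then have Y: "Y \<ge> 0" by (simp add: Y_def pos_op_def)
  define k where "k = (norm x)\<^sup>2 * Y"
  have k: "k \<ge> 0" using Y by (simp add: k_def)
  \<comment> \<open>The excess caused by the shift is \<open>\<delta> * k \<le> e\<close>; the 1 in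
    the denominator covers \<open>k = 0\<close>.\<close>
  define \<delta> where "\<delta> = e / (k + 1)"
  have \<delta>: "\<delta> > 0" using e k by (simp add: \<delta>_def)
  obtain \<epsilon> where \<epsilon>: "\<epsilon> > 0" "\<And>t. t \<ge> 0 \<Longrightarrow> (t + \<epsilon>) powr \<alpha> \<le> rpow \<alpha> t + \<delta>"
    using ex_powr_shift_le[OF \<alpha> \<delta>] by blast
  have c: "continuous_on {0..} (rpow \<alpha>)" by (rule continuous_on_rpow[OF \<alpha>(1)])
  have "Re (cinner (op_cfc (\<lambda>t. (t + \<epsilon>) powr \<alpha>) ?P x) x)
      \<le> Re (cinner (op_cfc (\<lambda>t. rpow \<alpha> t + \<delta>) ?P x) x)"
    using \<epsilon> by (intro op_cfc_mono[OF P]) (auto intro!: continuous_intros c)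
  also have "\<dots> = X + \<delta> * (norm x)\<^sup>2"
    by (simp add: op_cfc_add[OF P c] op_cfc_const[OF P] X_def op_powr_eq_cfc blinfun.add_left
        blinfun.scaleR_left cinner_add_left cinner_scaleR_left Re_cinner_self)
  finally have "(cmod (cinner (S x) y))\<^sup>2 \<le> (X + \<delta> * (norm x)\<^sup>2) * Y"
    using mixed_Schwarz_shifted[OF S \<alpha> \<epsilon>(1), of x y] Y
    by (auto simp: Y_def intro: order_trans mult_right_mono)
  also have "\<dots> = X * Y + \<delta> * k" by (simp add: k_def algebra_simps)
  also have "\<delta> * k \<le> e" using e k by (simp add: \<delta>_def field_simps)
  finally show "(cmod (cinner (S x) y))\<^sup>2 \<le> X * Y + e" by simp
qed

text \<open>Stated for a general operator because it is used twice, for \<open>S\<close> and for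
  \<open>adj S o\<^sub>L S\<close>.\<close>

lemma cmod_cinner_powr_le:
  fixes S :: "'a::chilbert_space \<Rightarrow>\<^sub>L 'a"
  assumes S: "clinear_op S" and \<alpha>: "0 \<le> \<alpha>" "\<alpha> \<le> 1" and r: "r \<ge> 1" and x: "norm x = 1"
  shows "cmod (cinner (S x) x) powr r \<le>
    1 / 2 * Re (cinner ((op_powr (op_abs S) (2 * r * \<alpha>)
      + op_powr (op_abs (adj S)) (2 * r * (1 - \<alpha>))) x) x)"
proof -
  have S': "clinear_op (adj S)" by (rule clinear_op_adj[OF S])
  let ?P = "adj S o\<^sub>L S" and ?Q = "S o\<^sub>L adj S"
  have P: "pos_op ?P" by (rule pos_op_adj_compose[OF S])
  have Q: "pos_op ?Q" using pos_op_adj_compose[OF S'] by (simp add: adj_adj[OF S])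
  define X Y where "X = Re (cinner (op_powr ?P \<alpha> x) x)" and "Y = Re (cinner (op_powr ?Q (1 - \<alpha>) x) x)"
  have XY: "X \<ge> 0" "Y \<ge> 0"
    using pos_op_powr[OF P, of \<alpha>] pos_op_powr[OF Q, of "1 - \<alpha>"] \<alpha> by (auto simp: X_def Y_def pos_op_def)
  have "cmod (cinner (S x) x) powr r = ((cmod (cinner (S x) x))\<^sup>2) powr (r / 2)"
    by (cases "cinner (S x) x = 0") (simp_all add: powr_powr flip: powr_numeral)
  also have "\<dots> \<le> (X * Y) powr (r / 2)"
    unfolding X_def Y_def using r by (intro powr_mono2 mixed_Schwarz S \<alpha>) auto
  also have "\<dots> = X powr (r / 2) * Y powr (r / 2)" by (rule powr_mult)
  \<comment> \<open>The arithmetic-geometric mean inequality, from the square of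
    \<open>X powr (r / 2) - Y powr (r / 2)\<close>.\<close>
  also have "\<dots> \<le> 1 / 2 * (X powr r + Y powr r)"
  proof -
    have sq: "z powr r = (z powr (r / 2))\<^sup>2" for z :: real
      by (simp add: power2_eq_square flip: powr_add)
    show ?thesis
      using zero_le_power2[of "X powr (r / 2) - Y powr (r / 2)"]
      unfolding sq[of X] sq[of Y] power2_diff by simp
  qed
  also have "\<dots> \<le> 1 / 2 * (Re (cinner (op_powr ?P (\<alpha> * r) x) x)
      + Re (cinner (op_powr ?Q ((1 - \<alpha>) * r) x) x))"
    unfolding X_def Y_def
    using McCarthy_inequality[OF P \<alpha>(1) r x] McCarthy_inequality[OF Q _ r x, of "1 - \<alpha>"] \<alpha>
    by (intro mult_left_mono add_mono) auto
  also have "op_powr ?P (\<alpha> * r) = op_powr (op_abs S) (2 * r * \<alpha>)"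
    using op_powr_abs[OF S, of "\<alpha> * r"] \<alpha> r by (simp add: mult_ac)
  also have "op_powr ?Q ((1 - \<alpha>) * r) = op_powr (op_abs (adj S)) (2 * r * (1 - \<alpha>))"
    using op_powr_abs[OF S', of "(1 - \<alpha>) * r"] \<alpha> r by (simp add: mult_ac adj_adj[OF S])
  finally show ?thesis by (simp add: blinfun.add_left cinner_add_left)
qed

section \<open>The Davis--Wielandt radius\<close>

text \<open>Add the tangent inequalities at the midpoint \<open>s\<close> for \<open>u\<close> and
  \<open>v\<close>: the linear parts sum to \<open>2 * p * s powr p\<close>.\<close>

lemma powr_mean_le:
  fixes u v p :: real
  assumes "u \<ge> 0" "v \<ge> 0" "p \<ge> 1"
  shows "(u + v) powr p \<le> 2 powr (p - 1) * (u powr p + v powr p)"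
proof -
  define s where "s = (u + v) / 2"
  have s: "s \<ge> 0" using assms by (simp add: s_def)
  have "s powr (p - 1) * s = s powr p"
    using s powr_mult_base[of s "p - 1"] by (simp add: mult.commute)
  moreover have "p * s powr (p - 1) * u + p * s powr (p - 1) * v = 2 * (p * (s powr (p - 1) * s))"
    by (simp add: s_def algebra_simps)
  ultimately have "2 * s powr p \<le> u powr p + v powr p"
    using powr_tangent[OF assms(3) s assms(1)] powr_tangent[OF assms(3) s assms(2)]
    by (simp add: algebra_simps)
  then have "2 powr (p - 1) * (2 * s powr p) \<le> 2 powr (p - 1) * (u powr p + v powr p)"
    by (rule mult_left_mono) simp
  moreover have "2 powr (p - 1) * (2 * s powr p) = (2 * s) powr p"
    using powr_mult_base[of 2 "p - 1"] powr_mult[of 2 s p] by (simp add: mult_ac)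
  moreover have "2 * s = u + v" by (simp add: s_def)
  ultimately show ?thesis by simp
qed

theorem theorem5:
  fixes S :: "'a::chilbert_space \<Rightarrow>\<^sub>L 'a" and \<alpha> r :: real
  assumes "clinear_op S"
    and "0 \<le> \<alpha>" and "\<alpha> \<le> 1" and "2 \<le> r"
  shows "dw S powr r \<le> 2 powr (r / 2) / 4 *
    norm (op_powr (op_abs S) (2 * r * \<alpha>)
        + op_powr (op_abs (adj S)) (2 * r * (1 - \<alpha>))
        + op_powr (op_abs (adj S o\<^sub>L S)) (2 * r * \<alpha>)
        + op_powr (op_abs (adj S o\<^sub>L S)) (2 * r * (1 - \<alpha>)))"
proof (cases "{x::'a. norm x = 1} = {}")
  \<comment> \<open>On the zero space \<open>dw S\<close> is 0 by convention, and
    \<open>0 powr r = 0\<close>.\<close>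
  case True
  then have "dw S powr r = 0" by (simp add: dw_def)
  then show ?thesis by simp
next
  case False
  let ?P = "adj S o\<^sub>L S"
  let ?T1 = "op_powr (op_abs S) (2 * r * \<alpha>) + op_powr (op_abs (adj S)) (2 * r * (1 - \<alpha>))"
  let ?T2 = "op_powr (op_abs ?P) (2 * r * \<alpha>) + op_powr (op_abs ?P) (2 * r * (1 - \<alpha>))"
  define T where "T = ?T1 + ?T2"
  define C where "C = 2 powr (r / 2) / 4 * norm T"
  define d where "d = (\<lambda>x. sqrt ((cmod (cinner (S x) x))\<^sup>2 + norm (S x) ^ 4))"
  have sa: "selfadj ?P" using pos_op_adj_compose[OF assms(1)] by (simp add: pos_op_def)
  \<comment> \<open>Taking the root first gives a uniform bound for \<open>d\<close>, under which
    the supremum can be formed before it is raised to the power \<open>r\<close>.\<close>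
  have "d x \<le> C powr (1 / r)" if x: "norm x = 1" for x
  proof -
    \<comment> \<open>This turns \<open>norm (S x) ^ 4\<close> into the square of an inner product,
      to which the bound for operators applies again.\<close>
    have Px: "cmod (cinner (?P x) x) = (norm (S x))\<^sup>2"
    proof -
      have "cinner (?P x) x = cinner (S x) (S x)" by (simp add: cinner_adj'[OF assms(1)])
      moreover have "(norm (S x))\<^sup>2 \<le> cmod (cinner (S x) (S x))"
        using complex_Re_le_cmod[of "cinner (S x) (S x)"] by (simp add: Re_cinner_self)
      moreover have "cmod (cinner (S x) (S x)) \<le> (norm (S x))\<^sup>2"
        using cmod_cinner_le[of "S x" "S x"] by (simp add: power2_eq_square)
      ultimately show ?thesis by simp
    qed
    define u v where "u = cmod (cinner (S x) x)" and "v = cmod (cinner (?P x) x)"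
    have sq: "(z\<^sup>2) powr (r / 2) = z powr r" if "z \<ge> 0" for z :: real
      using that by (cases "z = 0") (simp_all add: powr_powr flip: powr_numeral)
    have d: "d x = sqrt (u\<^sup>2 + v\<^sup>2)"
      unfolding d_def u_def v_def Px by (simp flip: power_mult)
    have "d x powr r = (u\<^sup>2 + v\<^sup>2) powr (r / 2)"
      using sq[of "d x"] by (simp add: d)
    also have "\<dots> \<le> 2 powr (r / 2 - 1) * ((u\<^sup>2) powr (r / 2) + (v\<^sup>2) powr (r / 2))"
      using assms(4) by (intro powr_mean_le) auto
    also have "\<dots> = 2 powr (r / 2 - 1) * (u powr r + v powr r)"
      by (simp add: sq u_def v_def)
    also have "\<dots> \<le> 2 powr (r / 2 - 1) *
        (1 / 2 * Re (cinner (?T1 x) x) + 1 / 2 * Re (cinner (?T2 x) x))"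
      unfolding u_def v_def
      using cmod_cinner_powr_le[OF assms(1-3) _ x, of r] assms(4)
        cmod_cinner_powr_le[OF clinear_op_selfadj[OF sa] assms(2,3) _ x, of r]
      by (intro mult_left_mono add_mono) (simp_all add: adj_selfadj[OF sa])
    also have "\<dots> = 2 powr (r / 2) / 4 * Re (cinner (T x) x)"
      by (simp add: T_def blinfun.add_left cinner_add_left powr_diff algebra_simps)
    also have "\<dots> \<le> C"
    proof -
      have "Re (cinner (T x) x) \<le> norm (T x) * norm x" by (rule Re_cinner_le)
      also have "\<dots> \<le> norm T" using norm_blinfun[of T x] x by simp
      finally show ?thesis by (simp add: C_def)
    qed
    finally have "(d x powr r) powr (1 / r) \<le> C powr (1 / r)"
      using assms(4) by (intro powr_mono2) auto
    moreover have "d x \<ge> 0" by (simp add: d_def)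
    ultimately show ?thesis using assms(4) by (simp add: powr_powr)
  qed
  then have bound: "(SUP x\<in>{x. norm x = 1}. d x) \<le> C powr (1 / r)"
    using False by (intro cSUP_least) auto
  obtain x where x: "norm (x::'a) = 1" using False by blast
  \<comment> \<open>Raising to the power \<open>r\<close> preserves the bound because the supremum
    is nonnegative.\<close>
  have "0 \<le> d x" by (simp add: d_def)
  also have "\<dots> \<le> (SUP x\<in>{x. norm x = 1}. d x)"
    by (rule cSUP_upper) (use x \<open>\<And>x. norm x = 1 \<Longrightarrow> d x \<le> C powr (1 / r)\<close> in \<open>auto intro!: bdd_aboveI\<close>)
  finally have "(SUP x\<in>{x. norm x = 1}. d x) powr r \<le> (C powr (1 / r)) powr r"
    using bound assms(4) by (intro powr_mono2) auto
  also have "\<dots> = C" using assms(4) by (simp add: powr_powr C_def)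
  finally show ?thesis
    using False by (simp add: dw_def d_def C_def T_def add.assoc)
qed

end
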